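(* Let $X=\{0,1\}$ and let $X^*\bowtie\mathbb{N}$ be the Zappa--Szép product semigroup coming from the binary adding machine. There is an isomorphism $\phi:\mathcal{Q}_2\to\mathcal{Q}(X^*\bowtie\mathbb{N})$ such that $\phi(u)=s_\gamma$ and $\phi(s_2)=t_0$.
   Context: $\mathcal{Q}_2$, the 2-adic ring $C^*$-algebra of the integers, is the universal $C^*$-algebra generated by a unitary $u$ and an isometry $s_2$ satisfying (I) $s_2u=u^2s_2$ and (II) $s_2s_2^*+us_2s_2^*u^*=1$. Let $X^*$ be the semigroup of finite words in $X=\{0,1\}$ under concatenation, with identity the empty word $\varnothing$. Write $\mathbb{N}=\langle e,\gamma\rangle=\{\gamma^n:n\ge0\}$, where $e=\gamma^0$. The binary adding machine is given on generators by $\gamma\cdot0=1$, $\gamma\cdot1=0$, $\gamma|_0=e$, $\gamma|_1=\gamma$; it extends to maps $\mathbb{N}\times X^*\to X^*$, $(g,w)\mapsto g\cdot w$, and $\mathbb{N}\times X^*\to\mathbb{N}$, $(g,w)\mapsto g|_w$, by $g\cdot\varnothing=\varnothing$, $g|_\varnothing=g$, $g\cdot(vw)=(g\cdot v)(g|_v\cdot w)$, $g|_{vw}=(g|_v)|_w$, $e\cdot w=w$, $e|_w=e$, $(gh)\cdot w=g\cdot(h\cdot w)$, $(gh)|_w=g|_{h\cdot w}\,h|_w$. The Zappa--Szép product $X^*\bowtie\mathbb{N}$ is the set $X^*\times\mathbb{N}$ with multiplication $(w,g)(z,h)=(w(g\cdot z),\,g|_z h)$. It is a left-cancellative right LCM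 semigroup (a nonempty intersection of two principal right ideals is a principal right ideal). For such a semigroup $P$, put $pY=\{py:y\in Y\}$ for $Y\subseteq P$, and $\mathcal{J}(P)=\{pP:p\in P\}\cup\{\varnothing\}$. A subset $F\subseteq P$ is a foundation set if it is finite and for each $p\in P$ there is $q\in F$ with $pP\cap qP\neq\varnothing$. The boundary quotient $\mathcal{Q}(P)$ is the universal $C^*$-algebra generated by isometries $\{w_p:p\in P\}$ and projections $\{e_Y:Y\in\mathcal{J}(P)\}$ satisfying $w_pw_q=w_{pq}$; $w_pe_Yw_p^*=e_{pY}$; $e_P=1$, $e_\varnothing=0$; $e_Ye_Z=e_{Y\cap Z}$; and $\prod_{p\in F}(1-e_{pP})=0$ for all foundation sets $F\subseteq P$. In $\mathcal{Q}(X^*\bowtie\mathbb{N})$ write $t_x:=w_{(x,e)}$ for $x\in X^*$ and $s_g:=w_{(\varnothing,g)}$ for $g\in\mathbb{N}$ (the canonical generators); thus $s_\gamma=w_{(\varnothing,\gamma)}$ and $t_0=w_{(0,e)}$. *)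

theory Defs
  imports Complex_Main "HOL-Library.Poly_Mapping" "HOL-Algebra.QuotRing"
begin

section \<open>Star-algebra structures\<close>

record 'a star_algebra = "'a ring" +
  scale :: "complex \<Rightarrow> 'a \<Rightarrow> 'a"
  star :: "'a \<Rightarrow> 'a"
  cnorm :: "'a \<Rightarrow> real"

definition star_hom ::
  "('a, 'c) star_algebra_scheme \<Rightarrow> ('b, 'd) star_algebra_scheme \<Rightarrow> ('a \<Rightarrow> 'b) \<Rightarrow> bool"
  where "star_hom A B \<phi> \<longleftrightarrow> \<phi> \<in> ring_hom A B
    \<and> (\<forall>c. \<forall>x\<in>carrier A. \<phi> (scale A c x) = scale B c (\<phi> x))
    \<and> (\<forall>x\<in>carrier A. \<phi> (star A x) = star B (\<phi> x))"

text \<open>An isomorphism of C*-algebras is a bijective *-homomorphism (here unital, since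
  \<^const>\<open>ring_hom\<close> preserves the unit).\<close>

definition star_iso ::
  "('a, 'c) star_algebra_scheme \<Rightarrow> ('b, 'd) star_algebra_scheme \<Rightarrow> ('a \<Rightarrow> 'b) \<Rightarrow> bool"
  where "star_iso A B \<phi> \<longleftrightarrow> star_hom A B \<phi> \<and> bij_betw \<phi> (carrier A) (carrier B)"


section \<open>Free unital *-algebras\<close>

text \<open>The free unital *-algebra is the complex monoid algebra of the free monoid on the
  generators and their formal adjoints; its product is the convolution product that
  \<^theory>\<open>HOL-Library.Poly_Mapping\<close> provides once lists form an additive monoid under
  concatenation.\<close>

instantiation list :: (type) monoid_add
begin
definition zero_list :: "'a list" where "zero_list = []"
definition plus_list :: "'a list \<Rightarrow> 'a list \<Rightarrow> 'a list" where "plus_list = (@)"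
instance by standard (simp_all add: zero_list_def plus_list_def)
end

datatype 'g letter = Gen 'g | Adj 'g

type_synonym 'g falg = "'g letter list \<Rightarrow>\<^sub>0 complex"

fun adj_letter :: "'g letter \<Rightarrow> 'g letter" where
  "adj_letter (Gen g) = Adj g"
| "adj_letter (Adj g) = Gen g"

definition adj_word :: "'g letter list \<Rightarrow> 'g letter list"
  where "adj_word w = rev (map adj_letter w)"

definition fstar :: "'g falg \<Rightarrow> 'g falg"
  where "fstar x = (\<Sum>w\<in>Poly_Mapping.keys x.
    Poly_Mapping.single (adj_word w) (cnj (Poly_Mapping.lookup x w)))"

definition fscale :: "complex \<Rightarrow> 'g falg \<Rightarrow> 'g falg"
  where "fscale c x = Poly_Mapping.single [] c * x"

definition gen :: "'g \<Rightarrow> 'g falg"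
  where "gen g = Poly_Mapping.single [Gen g] 1"

text \<open>The free unital *-algebra on the subset \<open>G\<close> of the type of names.\<close>

definition free_alg :: "'g set \<Rightarrow> 'g falg set"
  where "free_alg G = {x. Poly_Mapping.keys x \<subseteq> lists (Gen ` G \<union> Adj ` G)}"


section \<open>The universal C*-algebra on generators and relations\<close>

definition cstar_seminorm :: "'g set \<Rightarrow> ('g falg \<Rightarrow> real) \<Rightarrow> bool"
  where "cstar_seminorm G p \<longleftrightarrow>
    (\<forall>x\<in>free_alg G. 0 \<le> p x) \<and>
    (\<forall>c. \<forall>x\<in>free_alg G. p (fscale c x) = cmod c * p x) \<and>
    (\<forall>x\<in>free_alg G. \<forall>y\<in>free_alg G. p (x + y) \<le> p x + p y) \<and>
    (\<forall>x\<in>free_alg G. \<forall>y\<in>free_alg G. p (x * y) \<le> p x * p y) \<and>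
    (\<forall>x\<in>free_alg G. p (fstar x * x) = (p x)\<^sup>2)"

text \<open>\<open>R\<close> is a set of relators: \<open>r \<in> R\<close> stands for the relation \<open>r = 0\<close>.  The C*-seminorms on
  the free *-algebra that vanish on \<open>R\<close> are exactly the functions \<open>x \<mapsto> \<parallel>\<pi>(x)\<parallel>\<close> for unital
  *-homomorphisms \<open>\<pi>\<close> into C*-algebras that satisfy the relations, so \<open>univ_norm\<close> is the
  supremum of \<open>\<parallel>\<pi>(x)\<parallel>\<close> over all representations of the presentation.  It is meant for
  presentations that bound the generators, so that the supremum is finite; here every generator
  is an isometry or a projection.\<close>

definition univ_norm :: "'g set \<Rightarrow> 'g falg set \<Rightarrow> 'g falg \<Rightarrow> real"
  where "univ_norm G R x = (SUP p \<in> {p. cstar_seminorm G p \<and> (\<forall>r\<in>R. p r = 0)}. p x)"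

definition cauchy_ring :: "'g set \<Rightarrow> 'g falg set \<Rightarrow> (nat \<Rightarrow> 'g falg) ring"
  where "cauchy_ring G R =
    \<lparr>carrier = {X. (\<forall>n. X n \<in> free_alg G) \<and>
        (\<forall>\<epsilon>>0. \<exists>M. \<forall>m\<ge>M. \<forall>n\<ge>M. univ_norm G R (X m - X n) < \<epsilon>)},
     mult = (\<lambda>X Y n. X n * Y n), one = (\<lambda>_. 1),
     zero = (\<lambda>_. 0), add = (\<lambda>X Y n. X n + Y n)\<rparr>"

definition null_ideal :: "'g set \<Rightarrow> 'g falg set \<Rightarrow> (nat \<Rightarrow> 'g falg) set"
  where "null_ideal G R = {X. (\<forall>n. X n \<in> free_alg G) \<and> (\<lambda>n. univ_norm G R (X n)) \<longlonglongrightarrow> 0}"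

definition cauchy_class ::
  "'g set \<Rightarrow> 'g falg set \<Rightarrow> (nat \<Rightarrow> 'g falg) \<Rightarrow> (nat \<Rightarrow> 'g falg) set"
  where "cauchy_class G R X = null_ideal G R +>\<^bsub>cauchy_ring G R\<^esub> X"

text \<open>The separated completion of the free *-algebra with respect to \<open>univ_norm\<close>: Cauchy
  sequences modulo null sequences.  This is the universal C*-algebra generated by \<open>G\<close> subject to
  \<open>R\<close>: a family in a unital C*-algebra satisfying the relations induces a unital *-homomorphism
  on the free *-algebra that is contractive for \<open>univ_norm\<close> and hence extends uniquely.\<close>

definition univ_cstar :: "'g set \<Rightarrow> 'g falg set \<Rightarrow> (nat \<Rightarrow> 'g falg) set star_algebra"
  where "univ_cstar G R = ring.extend (cauchy_ring G R Quot null_ideal G R)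
    (star_algebra.fields
      (\<lambda>c A. \<Union>X\<in>A. cauchy_class G R (\<lambda>n. fscale c (X n)))
      (\<lambda>A. \<Union>X\<in>A. cauchy_class G R (\<lambda>n. fstar (X n)))
      (\<lambda>A. THE r. \<forall>X\<in>A. (\<lambda>n. univ_norm G R (X n)) \<longlonglongrightarrow> r))"

definition univ_gen :: "'g set \<Rightarrow> 'g falg set \<Rightarrow> 'g \<Rightarrow> (nat \<Rightarrow> 'g falg) set"
  where "univ_gen G R g = cauchy_class G R (\<lambda>_. gen g)"


section \<open>The 2-adic ring C*-algebra of the integers\<close>

datatype q2_name = U | S2

definition q2_relators :: "q2_name falg set"
  where "q2_relators = (let u = gen U; s = gen S2 in
    {fstar u * u - 1, u * fstar u - 1, fstar s * s - 1,
     s * u - u ^ 2 * s,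
     s * fstar s + u * s * fstar s * fstar u - 1})"

definition Q2 :: "(nat \<Rightarrow> q2_name falg) set star_algebra"
  where "Q2 = univ_cstar UNIV q2_relators"

definition q2_u :: "(nat \<Rightarrow> q2_name falg) set"
  where "q2_u = univ_gen UNIV q2_relators U"

definition q2_s2 :: "(nat \<Rightarrow> q2_name falg) set"
  where "q2_s2 = univ_gen UNIV q2_relators S2"


section \<open>The boundary quotient of a right LCM semigroup with identity\<close>

definition principal :: "('p, 'c) monoid_scheme \<Rightarrow> 'p \<Rightarrow> 'p set"
  where "principal P p = p <#\<^bsub>P\<^esub> carrier P"

definition ideals_J :: "('p, 'c) monoid_scheme \<Rightarrow> 'p set set"
  where "ideals_J P = principal P ` carrier P \<union> {{}}"

definition foundation_set :: "('p, 'c) monoid_scheme \<Rightarrow> 'p set \<Rightarrow> bool"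
  where "foundation_set P F \<longleftrightarrow> finite F \<and> F \<subseteq> carrier P \<and>
    (\<forall>p\<in>carrier P. \<exists>q\<in>F. principal P p \<inter> principal P q \<noteq> {})"

datatype 'p bq_name = W 'p | E "'p set"

definition bq_names :: "('p, 'c) monoid_scheme \<Rightarrow> 'p bq_name set"
  where "bq_names P = W ` carrier P \<union> E ` ideals_J P"

text \<open>The product over a foundation set is imposed for every enumeration of the set, because
  the free *-algebra is not commutative; modulo the other relators the order is irrelevant.\<close>

definition bq_relators :: "('p, 'c) monoid_scheme \<Rightarrow> 'p bq_name falg set"
  where "bq_relators P = (let w = (\<lambda>p. gen (W p)); e = (\<lambda>Y. gen (E Y)) in
      {fstar (w p) * w p - 1 | p. p \<in> carrier P}
    \<union> {e Y * e Y - e Y | Y. Y \<in> ideals_J P}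
    \<union> {fstar (e Y) - e Y | Y. Y \<in> ideals_J P}
    \<union> {w p * w q - w (p \<otimes>\<^bsub>P\<^esub> q) | p q. p \<in> carrier P \<and> q \<in> carrier P}
    \<union> {w p * e Y * fstar (w p) - e (p <#\<^bsub>P\<^esub> Y) | p Y. p \<in> carrier P \<and> Y \<in> ideals_J P}
    \<union> {e (carrier P) - 1, e {}}
    \<union> {e Y * e Z - e (Y \<inter> Z) | Y Z. Y \<in> ideals_J P \<and> Z \<in> ideals_J P}
    \<union> {prod_list (map (\<lambda>p. 1 - e (principal P p)) ps) | ps.
         distinct ps \<and> foundation_set P (set ps)})"

definition boundary_quotient ::
  "('p, 'c) monoid_scheme \<Rightarrow> (nat \<Rightarrow> 'p bq_name falg) set star_algebra"
  where "boundary_quotient P = univ_cstar (bq_names P) (bq_relators P)"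

definition bq_w :: "('p, 'c) monoid_scheme \<Rightarrow> 'p \<Rightarrow> (nat \<Rightarrow> 'p bq_name falg) set"
  where "bq_w P p = univ_gen (bq_names P) (bq_relators P) (W p)"


section \<open>The binary adding machine and its Zappa-Szep product\<close>

datatype digit = D0 | D1

text \<open>The action and restriction of the generator \<open>\<gamma>\<close>.  The monoid generated by \<open>\<gamma>\<close> is
  represented by \<^typ>\<open>nat\<close> under addition, with \<open>n\<close> standing for \<open>\<gamma>\<^sup>n\<close>.\<close>

fun gamma_act :: "digit list \<Rightarrow> digit list" where
  "gamma_act [] = []"
| "gamma_act (D0 # w) = D1 # w"
| "gamma_act (D1 # w) = D0 # gamma_act w"

fun gamma_res :: "digit list \<Rightarrow> nat" where
  "gamma_res [] = 1"
| "gamma_res (D0 # w) = 0"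
| "gamma_res (D1 # w) = gamma_res w"

primrec act :: "nat \<Rightarrow> digit list \<Rightarrow> digit list" where
  "act 0 w = w"
| "act (Suc n) w = gamma_act (act n w)"

primrec res :: "nat \<Rightarrow> digit list \<Rightarrow> nat" where
  "res 0 w = 0"
| "res (Suc n) w = gamma_res (act n w) + res n w"

lemma act_Nil [simp]: "act n [] = []"
  by (induction n) auto

lemma res_Nil [simp]: "res n [] = n"
  by (induction n) auto

lemma act_add: "act (m + n) w = act m (act n w)"
  by (induction m) auto

lemma res_add: "res (m + n) w = res m (act n w) + res n w"
  by (induction m) (auto simp: act_add)

lemma gamma_act_append: "gamma_act (v @ w) = gamma_act v @ act (gamma_res v) w"
  by (induction v rule: gamma_act.induct) auto

lemma gamma_res_append: "gamma_res (v @ w) = res (gamma_res v) w"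
  by (induction v rule: gamma_act.induct) auto

lemma act_append: "act n (v @ w) = act n v @ act (res n v) w"
  by (induction n) (auto simp: gamma_act_append act_add)

lemma res_append: "res n (v @ w) = res (res n v) w"
  by (induction n) (auto simp: act_append gamma_res_append res_add)

definition adding_machine_zs :: "(digit list \<times> nat) monoid"
  where "adding_machine_zs =
    \<lparr>carrier = UNIV,
     mult = (\<lambda>(w, g) (z, h). (w @ act g z, res g z + h)),
     one = ([], 0)\<rparr>"

lemma monoid_adding_machine_zs: "monoid adding_machine_zs"
  by unfold_locales
    (auto simp: adding_machine_zs_def act_append res_append act_add res_add)

definition zs_t :: "digit list \<Rightarrow> (nat \<Rightarrow> (digit list \<times> nat) bq_name falg) set"
  where "zs_t x = bq_w adding_machine_zs (x, 0)"

definition zs_s :: "nat \<Rightarrow> (nat \<Rightarrow> (digit list \<times> nat) bq_name falg) set"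
  where "zs_s g = bq_w adding_machine_zs ([], g)"

end

theory Submission
  imports Defs "HOL-Library.Sublist"
begin

text \<open>
  Both algebras are presented by generators and relations, and each set of generators can be written
  in terms of the other: \<open>u\<close> and \<open>s\<^sub>2\<close> go to the isometries of \<open>\<gamma>\<close> and of the word \<open>0\<close>, while the
  isometry of a pair \<open>(x, \<gamma>\<^sup>n)\<close> goes to \<open>s\<^sub>x u\<^sup>n\<close>, where \<open>s\<^sub>x\<close> is the product of the isometries
  \<open>s\<^sub>0 = s\<^sub>2\<close> and \<open>s\<^sub>1 = u s\<^sub>2\<close> along the word \<open>x\<close>, and the projection of a principal ideal \<open>pP\<close>
  goes to the range projection of the image of \<open>w\<^sub>p\<close>.  The theorem holds because these two
  substitutions respect the relations and are inverse to each other.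

  From the boundary quotient to the 2-adic ring algebra: the singleton of \<open>\<gamma>\<close> is a foundation set,
  which makes \<open>w\<^sub>\<gamma>\<close> unitary; the words \<open>0\<close> and \<open>1\<close> form a foundation set and generate disjoint ideals,
  which makes the ranges of \<open>s\<^sub>0\<close> and \<open>s\<^sub>1\<close> add up to \<open>1\<close>; and \<open>s\<^sub>2 u = u\<^sup>2 s\<^sub>2\<close> is an identity in the
  semigroup.  Conversely, \<open>s\<^sub>2 u = u\<^sup>2 s\<^sub>2\<close> is the carry rule of the adding machine, so that \<open>s\<^sub>x u\<^sup>n\<close>
  multiplies as the Zappa-Szep product does (\<open>el_mult\<close>).  As \<open>u\<close> is unitary, the range of \<open>s\<^sub>x u\<^sup>n\<close>
  depends on \<open>x\<close> alone, and these ranges intersect as the principal ideals do: they are orthogonal for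
  incomparable words and nested for comparable ones (\<open>ideal_proj_inter\<close>).  Finally the words of a fixed
  length have ranges adding up to \<open>1\<close>, and every word that is long enough has a prefix in a given
  foundation set, whence the product over the foundation set vanishes (\<open>foundation_product\<close>).

  The universal C*-algebra is the completion of a free *-algebra in the supremum of all C*-seminorms
  that vanish on the relators.  A substitution that respects the relators pulls such seminorms back to
  such seminorms, so it is contractive and passes to the completions; two mutually inverse
  substitutions give an isomorphism (\<open>univ_cstar_iso\<close>).  All relations are verified in the quotients
  of the free algebras by the elements that every one of these seminorms kills, that is, by
  computation in a ring with involution.
\<close>

section \<open>The universal property of the free unital *-algebra\<close>

lemma poly_mapping_sum_single:
  "(\<Sum>k\<in>Poly_Mapping.keys x. Poly_Mapping.single k (Poly_Mapping.lookup x k)) = x"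
  by (rule poly_mapping_eqI) (auto simp: lookup_sum lookup_single when_def in_keys_iff)

lemma poly_mapping_induct [case_names single add]:
  fixes x :: "'k \<Rightarrow>\<^sub>0 'b::comm_monoid_add"
  assumes single: "\<And>k c. P (Poly_Mapping.single k c)"
    and add: "\<And>x y. P x \<Longrightarrow> P y \<Longrightarrow> P (x + y)"
  shows "P x"
proof -
  have "P (\<Sum>k\<in>A. Poly_Mapping.single k (Poly_Mapping.lookup x k))" if "finite A" for A
    using that
  proof induction
    case empty
    show ?case using single[of undefined 0] by simp
  qed (simp add: single add)
  then show ?thesis
    by (metis poly_mapping_sum_single finite_keys)
qed

lemma mult_single_words:
  "Poly_Mapping.single v a * Poly_Mapping.single w b = Poly_Mapping.single (v @ w) (a * b :: complex)"
  by (simp add: mult_single plus_list_def)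

lemma one_eq_single: "(1 :: 'g falg) = Poly_Mapping.single [] 1"
  by (simp flip: zero_list_def)

lemma scalar_central: "x * Poly_Mapping.single [] c = Poly_Mapping.single [] c * (x :: 'g falg)"
  by (induction x rule: poly_mapping_induct) (simp_all add: mult_single_words algebra_simps)

lemma adj_word_append: "adj_word (v @ w) = adj_word w @ adj_word v"
  by (simp add: adj_word_def)

lemma adj_word_adj_word [simp]: "adj_word (adj_word w) = w"
proof -
  have "adj_letter (adj_letter l) = l" for l :: "'a letter"
    by (cases l) auto
  then show ?thesis
    by (induction w) (simp_all add: adj_word_def)
qed

lemma fstar_single [simp]:
  "fstar (Poly_Mapping.single w c) = Poly_Mapping.single (adj_word w) (cnj c)"
  by (cases "c = 0") (simp_all add: fstar_def)

lemma fstar_add [simp]: "fstar (x + y) = fstar x + fstar y"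
  unfolding fstar_def by (rule setsum_keys_plus_distrib) (simp_all add: single_add)

lemma fstar_mult [simp]: "fstar (x * y) = fstar y * fstar x"
proof (induction x rule: poly_mapping_induct)
  case (single v a)
  show ?case
    by (induction y rule: poly_mapping_induct)
      (simp_all add: mult_single_words adj_word_append algebra_simps)
qed (simp add: algebra_simps)

lemma fstar_fstar [simp]: "fstar (fstar x) = x"
  by (induction x rule: poly_mapping_induct) simp_all

lemma fstar_0 [simp]: "fstar 0 = 0"
  by (simp add: fstar_def)

lemma fstar_1 [simp]: "fstar 1 = 1"
  by (simp add: one_eq_single adj_word_def)

lemma fstar_minus [simp]: "fstar (- x) = - fstar x"
  by (rule minus_unique[symmetric]) (simp flip: fstar_add)

lemma fstar_diff [simp]: "fstar (x - y) = fstar x - fstar y"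
  by (simp only: diff_conv_add_uminus fstar_add fstar_minus)

lemma fstar_fscale: "fstar (fscale c x) = fscale (cnj c) (fstar x)"
  by (simp add: fscale_def adj_word_def scalar_central)

lemma fscale_diff: "fscale c (x - y) = fscale c x - fscale c y"
  by (simp add: fscale_def algebra_simps)

lemma fscale_minus_one: "fscale (-1) x = - x"
  by (simp add: fscale_def single_uminus flip: one_eq_single)

lemma free_alg_zero [simp]: "0 \<in> free_alg G"
  by (simp add: free_alg_def)

lemma free_alg_scalar [simp]: "Poly_Mapping.single [] c \<in> free_alg G"
  by (simp add: free_alg_def)

lemma free_alg_one [simp]: "1 \<in> free_alg G"
  by (simp add: one_eq_single)

lemma free_alg_gen [simp]: "g \<in> G \<Longrightarrow> gen g \<in> free_alg G"
  by (simp add: free_alg_def gen_def)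

lemma free_alg_add [simp]: "x \<in> free_alg G \<Longrightarrow> y \<in> free_alg G \<Longrightarrow> x + y \<in> free_alg G"
  using keys_add[of x y] unfolding free_alg_def by blast

lemma free_alg_mult [simp]: "x \<in> free_alg G \<Longrightarrow> y \<in> free_alg G \<Longrightarrow> x * y \<in> free_alg G"
proof -
  assume xy: "x \<in> free_alg G" "y \<in> free_alg G"
  have "u \<in> lists (Gen ` G \<union> Adj ` G)" if u: "u \<in> Poly_Mapping.keys (x * y)" for u
  proof -
    obtain v w where "u = v @ w" "v \<in> Poly_Mapping.keys x" "w \<in> Poly_Mapping.keys y"
      using subsetD[OF keys_mult u] unfolding plus_list_def by blast
    then show ?thesis
      using xy unfolding free_alg_def by (metis append_in_lists_conv mem_Collect_eq subsetD)
  qed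
  then show ?thesis
    unfolding free_alg_def by blast
qed

lemma free_alg_fscale [simp]: "x \<in> free_alg G \<Longrightarrow> fscale c x \<in> free_alg G"
  by (simp add: fscale_def)

lemma free_alg_minus [simp]: "x \<in> free_alg G \<Longrightarrow> - x \<in> free_alg G"
  using free_alg_fscale[of x G "-1"] by (simp add: fscale_minus_one)

lemma free_alg_diff [simp]: "x \<in> free_alg G \<Longrightarrow> y \<in> free_alg G \<Longrightarrow> x - y \<in> free_alg G"
  using free_alg_add[of x G "- y"] by simp

lemma free_alg_fstar [simp]:
  assumes "x \<in> free_alg G" shows "fstar x \<in> free_alg G"
proof -
  have "Poly_Mapping.single (adj_word w) c \<in> free_alg G"
    if w: "w \<in> Poly_Mapping.keys x" for w and c :: complex
  proof -
    have "adj_letter l \<in> Gen ` G \<union> Adj ` G" if "l \<in> set w" for l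
    proof -
      have "l \<in> Gen ` G \<union> Adj ` G"
        using w assms that by (auto simp: free_alg_def)
      then show ?thesis by auto
    qed
    then have "set (adj_word w) \<subseteq> Gen ` G \<union> Adj ` G"
      by (simp add: adj_word_def image_subset_iff del: Un_iff)
    then show ?thesis
      by (simp add: free_alg_def lists_eq_set del: Un_iff)
  qed
  moreover have "finite A \<Longrightarrow> (\<And>a. a \<in> A \<Longrightarrow> f a \<in> free_alg G) \<Longrightarrow> sum f A \<in> free_alg G"
    for A and f :: "'a letter list \<Rightarrow> 'a falg"
    by (induction A rule: finite_induct) simp_all
  ultimately show ?thesis
    by (simp add: fstar_def)
qed

lemma free_alg_UNIV [simp]: "free_alg UNIV = UNIV"
proof -
  have "l \<in> range Gen \<union> range Adj" for l :: "'a letter"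
    by (cases l) auto
  then show ?thesis by (auto simp: free_alg_def)
qed

lemma fstar_gen: "fstar (gen g) = Poly_Mapping.single [Adj g] 1"
  by (simp add: gen_def adj_word_def)

text \<open>Induction along the generation of the free algebra by the scalars, the generators and their
  adjoints.  It reduces the boundedness of seminorms and the agreement of homomorphisms to the
  generators.\<close>

lemma free_alg_induct [consumes 1, case_names scalar gen adj mult add]:
  assumes x: "x \<in> free_alg G"
    and scalar: "\<And>c. P (Poly_Mapping.single [] c)"
    and gen: "\<And>g. g \<in> G \<Longrightarrow> P (gen g)"
    and adj: "\<And>g. g \<in> G \<Longrightarrow> P (fstar (gen g))"
    and mult: "\<And>x y. x \<in> free_alg G \<Longrightarrow> y \<in> free_alg G \<Longrightarrow> P x \<Longrightarrow> P y \<Longrightarrow> P (x * y)"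
    and add: "\<And>x y. x \<in> free_alg G \<Longrightarrow> y \<in> free_alg G \<Longrightarrow> P x \<Longrightarrow> P y \<Longrightarrow> P (x + y)"
  shows "P x"
proof -
  define Q where "Q z \<longleftrightarrow> z \<in> free_alg G \<and> P z" for z
  have Q_word: "Q (Poly_Mapping.single w c)" if "set w \<subseteq> Gen ` G \<union> Adj ` G" for w and c :: complex
    using that
  proof (induction w)
    case Nil
    show ?case by (simp add: Q_def scalar)
  next
    case (Cons l w)
    have "Q (Poly_Mapping.single [l] 1)"
      using Cons.prems gen adj free_alg_gen free_alg_fstar[OF free_alg_gen]
      by (auto simp: Q_def simp flip: gen_def fstar_gen)
    moreover have "Poly_Mapping.single (l # w) c = Poly_Mapping.single [l] 1 * Poly_Mapping.single w c"
      by (simp add: mult_single_words)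
    ultimately show ?case
      using Cons mult by (simp add: Q_def)
  qed
  have "Q (\<Sum>k\<in>A. Poly_Mapping.single k (Poly_Mapping.lookup x k))"
    if "finite A" "A \<subseteq> Poly_Mapping.keys x" for A
    using that
  proof induction
    case empty
    show ?case using scalar[of 0] by (simp add: Q_def)
  next
    case (insert w A)
    have "Q (Poly_Mapping.single w (Poly_Mapping.lookup x w))"
      using insert.prems x by (intro Q_word) (auto simp: free_alg_def)
    with insert show ?case by (simp add: Q_def add)
  qed
  then show ?thesis
    unfolding Q_def by (metis poly_mapping_sum_single finite_keys order_refl)
qed

primrec letter_image :: "('g \<Rightarrow> 'h falg) \<Rightarrow> 'g letter \<Rightarrow> 'h falg" where
  "letter_image f (Gen g) = f g"
| "letter_image f (Adj g) = fstar (f g)"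

definition word_image :: "('g \<Rightarrow> 'h falg) \<Rightarrow> 'g letter list \<Rightarrow> 'h falg"
  where "word_image f w = prod_list (map (letter_image f) w)"

text \<open>The unital *-homomorphism that extends a map of the generators.\<close>

definition free_ext :: "('g \<Rightarrow> 'h falg) \<Rightarrow> 'g falg \<Rightarrow> 'h falg"
  where "free_ext f x = (\<Sum>w\<in>Poly_Mapping.keys x. fscale (Poly_Mapping.lookup x w) (word_image f w))"

lemma word_image_simps:
  "word_image f [] = 1"
  "word_image f (v @ w) = word_image f v * word_image f w"
  by (simp_all add: word_image_def)

lemma word_image_adj: "word_image f (adj_word w) = fstar (word_image f w)"
proof -
  have "letter_image f (adj_letter l) = fstar (letter_image f l)" for l
    by (cases l) simp_all
  then show ?thesis
    by (induction w) (simp_all add: word_image_def adj_word_def)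
qed

lemma free_ext_single: "free_ext f (Poly_Mapping.single w c) = fscale c (word_image f w)"
  by (cases "c = 0") (simp_all add: free_ext_def fscale_def)

lemma free_ext_add [simp]: "free_ext f (x + y) = free_ext f x + free_ext f y"
  unfolding free_ext_def
  by (rule setsum_keys_plus_distrib) (simp_all add: fscale_def single_add distrib_right)

lemma free_ext_mult [simp]: "free_ext f (x * y) = free_ext f x * free_ext f y"
proof (induction x rule: poly_mapping_induct)
  case (single v a)
  show ?case
  proof (induction y rule: poly_mapping_induct)
    case (single w b)
    have "Poly_Mapping.single [] (a * b) * (word_image f v * word_image f w) =
      Poly_Mapping.single [] a * (Poly_Mapping.single [] b * word_image f v) * word_image f w"
      by (simp add: mult_single_words flip: mult.assoc)
    also have "\<dots> = Poly_Mapping.single [] a * word_image f v * (Poly_Mapping.single [] b * word_image f w)"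
      by (simp add: mult.assoc scalar_central[of "word_image f v" b, symmetric])
    finally show ?case
      by (simp add: mult_single_words free_ext_single word_image_simps fscale_def)
  qed (simp add: distrib_left)
qed (simp add: distrib_right)

lemma free_ext_fstar [simp]: "free_ext f (fstar x) = fstar (free_ext f x)"
  by (induction x rule: poly_mapping_induct)
    (simp_all add: free_ext_single word_image_adj fstar_fscale)

lemma free_ext_0 [simp]: "free_ext f 0 = 0"
  by (simp add: free_ext_def)

lemma free_ext_scalar: "free_ext f (Poly_Mapping.single [] c) = Poly_Mapping.single [] c"
  by (simp add: free_ext_single word_image_simps fscale_def)

lemma free_ext_1 [simp]: "free_ext f 1 = 1"
  by (simp add: one_eq_single free_ext_scalar)

lemma free_ext_minus [simp]: "free_ext f (- x) = - free_ext f x"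
  by (rule minus_unique[symmetric]) (simp flip: free_ext_add)

lemma free_ext_diff [simp]: "free_ext f (x - y) = free_ext f x - free_ext f y"
  by (simp only: diff_conv_add_uminus free_ext_add free_ext_minus)

lemma free_ext_power [simp]: "free_ext f (x ^ n) = free_ext f x ^ n"
  by (induction n) simp_all

lemma free_ext_prod_list [simp]: "free_ext f (prod_list xs) = prod_list (map (free_ext f) xs)"
  by (induction xs) simp_all

lemma free_ext_fscale [simp]: "free_ext f (fscale c x) = fscale c (free_ext f x)"
  by (simp add: fscale_def free_ext_scalar)

lemma free_ext_gen [simp]: "free_ext f (gen g) = f g"
  by (simp add: gen_def free_ext_single word_image_def fscale_def flip: one_eq_single)

lemma free_ext_closed:
  assumes "f ` G \<subseteq> free_alg H" and "x \<in> free_alg G"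
  shows "free_ext f x \<in> free_alg H"
  using assms(2) by (induction x rule: free_alg_induct) (use assms(1) in \<open>auto simp: free_ext_scalar\<close>)

lemma free_ext_gen_id:
  assumes "\<And>g. g \<in> G \<Longrightarrow> f g = gen g" and "x \<in> free_alg G"
  shows "free_ext f x = x"
  using assms(2) by (induction x rule: free_alg_induct) (use assms(1) in \<open>auto simp: free_ext_scalar\<close>)


section \<open>C*-seminorms\<close>

context
  fixes G :: "'g set" and p :: "'g falg \<Rightarrow> real"
  assumes p: "cstar_seminorm G p"
begin

lemma cstar_seminorm_nonneg: "x \<in> free_alg G \<Longrightarrow> 0 \<le> p x"
  and cstar_seminorm_scale: "x \<in> free_alg G \<Longrightarrow> p (fscale c x) = cmod c * p x"
  and cstar_seminorm_add: "x \<in> free_alg G \<Longrightarrow> y \<in> free_alg G \<Longrightarrow> p (x + y) \<le> p x + p y"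
  and cstar_seminorm_mult: "x \<in> free_alg G \<Longrightarrow> y \<in> free_alg G \<Longrightarrow> p (x * y) \<le> p x * p y"
  and cstar_seminorm_cstar: "x \<in> free_alg G \<Longrightarrow> p (fstar x * x) = (p x)\<^sup>2"
  using p by (auto simp: cstar_seminorm_def)

lemma cstar_seminorm_zero: "p 0 = 0"
  using cstar_seminorm_scale[of 0 0] by (simp add: fscale_def)

lemma cstar_seminorm_minus: "x \<in> free_alg G \<Longrightarrow> p (- x) = p x"
  using cstar_seminorm_scale[of x "-1"] by (simp add: fscale_minus_one)

text \<open>From \<open>p(x)\<^sup>2 = p(x\<^sup>* x) \<le> p(x\<^sup>*) p(x)\<close> one gets \<open>p(x) \<le> p(x\<^sup>*)\<close>, and then equality by symmetry.\<close>

lemma cstar_seminorm_fstar: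
  assumes x: "x \<in> free_alg G"
  shows "p (fstar x) = p x"
proof -
  have le: "p y \<le> p (fstar y)" if y: "y \<in> free_alg G" for y
  proof (cases "p y = 0")
    case False
    have "p y * p y \<le> p (fstar y) * p y"
      using cstar_seminorm_cstar[OF y] cstar_seminorm_mult[of "fstar y" y] y
      by (simp add: power2_eq_square)
    moreover have "p y > 0"
      using False cstar_seminorm_nonneg[OF y] by simp
    ultimately show ?thesis by simp
  qed (use that cstar_seminorm_nonneg in simp)
  show ?thesis
    using le[OF x] le[of "fstar x"] x by simp
qed

lemma cstar_seminorm_scalar: "p (Poly_Mapping.single [] c) \<le> cmod c"
proof -
  have "p 1 * p 1 = p 1"
    using cstar_seminorm_cstar[of 1] by (simp add: power2_eq_square)
  then have "p 1 \<le> 1"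
    by (cases "p 1 = 0") auto
  then show ?thesis
    using cstar_seminorm_scale[of 1 c] mult_left_mono[of "p 1" 1 "cmod c"] by (simp add: fscale_def)
qed

lemma cstar_seminorm_gen_le_one:
  assumes g: "g \<in> G" and "p (fstar (gen g) * gen g - 1) = 0"
  shows "p (gen g) \<le> 1"
proof -
  have "(p (gen g))\<^sup>2 \<le> p (fstar (gen g) * gen g - 1) + p 1"
    using cstar_seminorm_add[of "fstar (gen g) * gen g - 1" 1] g
    by (simp add: cstar_seminorm_cstar)
  also have "p 1 \<le> 1"
    using cstar_seminorm_scalar[of 1] by (simp add: one_eq_single)
  finally show ?thesis
    using assms(2) power2_le_imp_le[of "p (gen g)" 1] by simp
qed

text \<open>Modulo the kernel of \<open>p\<close> the generator is a projection \<open>e\<close>, so \<open>p(e)\<^sup>2 = p(e\<^sup>* e) = p(e)\<close>.\<close>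

lemma cstar_seminorm_projection_le_one:
  assumes g: "g \<in> G" and idem: "p (gen g * gen g - gen g) = 0" and sa: "p (fstar (gen g) - gen g) = 0"
  shows "p (gen g) \<le> 1"
proof -
  let ?e = "gen g"
  have e: "?e \<in> free_alg G" using g by simp
  have "p ((fstar ?e - ?e) * ?e) \<le> 0"
    using cstar_seminorm_mult[of "fstar ?e - ?e" ?e] e sa by simp
  moreover have "fstar ?e * ?e = (fstar ?e - ?e) * ?e + ((?e * ?e - ?e) + ?e)"
    by (simp add: algebra_simps)
  then have "p (fstar ?e * ?e) \<le> p ((fstar ?e - ?e) * ?e) + (p (?e * ?e - ?e) + p ?e)"
    using cstar_seminorm_add[of "(fstar ?e - ?e) * ?e" "(?e * ?e - ?e) + ?e"]
      cstar_seminorm_add[of "?e * ?e - ?e" ?e] e by simp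
  ultimately have "p ?e * p ?e \<le> p ?e"
    using cstar_seminorm_cstar[OF e] idem by (simp add: power2_eq_square)
  then show ?thesis
    using cstar_seminorm_nonneg[OF e] by (cases "p ?e = 0") auto
qed

end

definition rep_seminorm :: "'g set \<Rightarrow> 'g falg set \<Rightarrow> ('g falg \<Rightarrow> real) \<Rightarrow> bool"
  where "rep_seminorm G R p \<longleftrightarrow> cstar_seminorm G p \<and> (\<forall>r\<in>R. p r = 0)"

text \<open>The elements that vanish in every representation, that is, in the universal C*-algebra.\<close>

definition vanishing :: "'g set \<Rightarrow> 'g falg set \<Rightarrow> 'g falg set"
  where "vanishing G R = {x \<in> free_alg G. \<forall>p. rep_seminorm G R p \<longrightarrow> p x = 0}"

lemma vanishingD: "x \<in> vanishing G R \<Longrightarrow> rep_seminorm G R p \<Longrightarrow> p x = 0"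
  by (simp add: vanishing_def)

lemma vanishing_free_alg: "x \<in> vanishing G R \<Longrightarrow> x \<in> free_alg G"
  by (simp add: vanishing_def)

lemma vanishing_relator: "r \<in> R \<Longrightarrow> r \<in> free_alg G \<Longrightarrow> r \<in> vanishing G R"
  by (simp add: vanishing_def rep_seminorm_def)

lemma vanishing_zero [simp]: "0 \<in> vanishing G R"
  by (auto simp: vanishing_def rep_seminorm_def cstar_seminorm_zero)

lemma vanishing_add:
  assumes "x \<in> vanishing G R" and "y \<in> vanishing G R"
  shows "x + y \<in> vanishing G R"
proof -
  have "p (x + y) = 0" if "rep_seminorm G R p" for p
    using that assms[THEN vanishingD, OF that] assms[THEN vanishing_free_alg]
      cstar_seminorm_add[of G p x y] cstar_seminorm_nonneg[of G p "x + y"]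
    by (simp add: rep_seminorm_def)
  then show ?thesis using assms by (simp add: vanishing_def)
qed

lemma vanishing_minus: "x \<in> vanishing G R \<Longrightarrow> - x \<in> vanishing G R"
  by (auto simp: vanishing_def rep_seminorm_def cstar_seminorm_minus)

lemma vanishing_fstar: "x \<in> vanishing G R \<Longrightarrow> fstar x \<in> vanishing G R"
  by (auto simp: vanishing_def rep_seminorm_def cstar_seminorm_fstar)

lemma vanishing_mult:
  assumes "x \<in> free_alg G" "y \<in> free_alg G" and "x \<in> vanishing G R \<or> y \<in> vanishing G R"
  shows "x * y \<in> vanishing G R"
proof -
  have "p (x * y) = 0" if "rep_seminorm G R p" for p
    using that assms cstar_seminorm_mult[of G p x y] cstar_seminorm_nonneg[of G p "x * y"]
    by (auto simp: vanishing_def rep_seminorm_def)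
  then show ?thesis using assms by (simp add: vanishing_def)
qed

text \<open>Pulling seminorms back is what makes a substitution contractive for the universal norms: the
  seminorms over which the supremum is taken on one side occur among those of the other side.\<close>

lemma cstar_seminorm_free_ext:
  assumes "f ` G \<subseteq> free_alg H" and "cstar_seminorm H p"
  shows "cstar_seminorm G (\<lambda>x. p (free_ext f x))"
  using assms(2) free_ext_closed[OF assms(1)] by (simp add: cstar_seminorm_def)

lemma rep_seminorm_free_ext:
  assumes f: "f ` G \<subseteq> free_alg H" and R: "free_ext f ` R \<subseteq> vanishing H S"
    and p: "rep_seminorm H S p"
  shows "rep_seminorm G R (\<lambda>x. p (free_ext f x))"
  using cstar_seminorm_free_ext[OF f] R p by (auto simp: rep_seminorm_def vanishing_def)

lemma free_ext_vanishing:
  assumes f: "f ` G \<subseteq> free_alg H" and R: "free_ext f ` R \<subseteq> vanishing H S" and x: "x \<in> vanishing G R"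
  shows "free_ext f x \<in> vanishing H S"
proof -
  have "p (free_ext f x) = 0" if "rep_seminorm H S p" for p
    using vanishingD[OF x rep_seminorm_free_ext[OF f R that]] .
  then show ?thesis
    using free_ext_closed[OF f] x by (simp add: vanishing_def)
qed

text \<open>Names outside \<open>G\<close> may be used freely when identities between elements of the free algebra on
  \<open>G\<close> are derived: sending them to \<open>0\<close> is a retraction onto that algebra.  So relations can be
  checked in a quotient of the free algebra on all names, which is a type.\<close>

lemma vanishing_UNIV_imp:
  assumes "R \<subseteq> free_alg G" and x: "x \<in> free_alg G" "x \<in> vanishing UNIV R"
  shows "x \<in> vanishing G R"
proof -
  define f where "f g = (if g \<in> G then gen g else 0)" for g
  have f_id: "free_ext f y = y" if "y \<in> free_alg G" for y
    using that by (rule free_ext_gen_id[rotated]) (simp add: f_def)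
  have "free_ext f ` R \<subseteq> vanishing G R"
    using assms(1) f_id vanishing_relator by (fastforce simp: subset_iff)
  then have "free_ext f x \<in> vanishing G R"
    using x(2) by (intro free_ext_vanishing[where G = UNIV]) (auto simp: f_def)
  then show ?thesis
    using f_id x by simp
qed

section \<open>The universal norm\<close>

text \<open>A presentation whose representations bound the generators; then the supremum that defines
  the universal norm is taken over a bounded set.\<close>

locale bounded_presentation =
  fixes G :: "'g set" and R :: "'g falg set"
  assumes gen_le_one: "\<And>p g. rep_seminorm G R p \<Longrightarrow> g \<in> G \<Longrightarrow> p (gen g) \<le> 1"
begin

abbreviation "N \<equiv> univ_norm G R"

lemma rep_seminorms_bounded:
  assumes "x \<in> free_alg G"
  shows "\<exists>C. \<forall>p. rep_seminorm G R p \<longrightarrow> p x \<le> C"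
  using assms
proof (induction x rule: free_alg_induct)
  case (scalar c)
  show ?case
    using cstar_seminorm_scalar unfolding rep_seminorm_def by blast
next
  case (gen g)
  then show ?case using gen_le_one by blast
next
  case (adj g)
  then have "p (fstar (gen g)) \<le> 1" if p: "rep_seminorm G R p" for p
    using p gen_le_one[OF p] cstar_seminorm_fstar[of G p "gen g"] by (simp add: rep_seminorm_def)
  then show ?case by blast
next
  case (mult x y)
  then obtain C D where CD: "\<forall>p. rep_seminorm G R p \<longrightarrow> p x \<le> C" "\<forall>p. rep_seminorm G R p \<longrightarrow> p y \<le> D"
    by blast
  have "p (x * y) \<le> C * D" if p: "rep_seminorm G R p" for p
  proof -
    have "p (x * y) \<le> p x * p y" and nonneg: "0 \<le> p x" "0 \<le> p y"
      using p mult.hyps by (auto simp: rep_seminorm_def cstar_seminorm_mult cstar_seminorm_nonneg)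
    moreover have "p x \<le> C" and "p y \<le> D"
      using p CD by blast+
    then have "p x * p y \<le> C * D"
      using nonneg by (intro mult_mono) auto
    ultimately show ?thesis by simp
  qed
  then show ?case by blast
next
  case (add x y)
  then obtain C D where CD: "\<forall>p. rep_seminorm G R p \<longrightarrow> p x \<le> C" "\<forall>p. rep_seminorm G R p \<longrightarrow> p y \<le> D"
    by blast
  have "p (x + y) \<le> C + D" if p: "rep_seminorm G R p" for p
  proof -
    have "p (x + y) \<le> p x + p y"
      using p add.hyps cstar_seminorm_add[of G p x y] by (simp add: rep_seminorm_def)
    also have "\<dots> \<le> C + D"
      using p CD by (simp add: add_mono)
    finally show ?thesis .
  qed
  then show ?case by blast
qed

lemma rep_seminorm_zero: "rep_seminorm G R (\<lambda>_. 0)"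
  by (simp add: rep_seminorm_def cstar_seminorm_def)

lemma univ_norm_alt: "N x = (SUP p\<in>Collect (rep_seminorm G R). p x)"
  by (simp add: univ_norm_def rep_seminorm_def[abs_def])

lemma univ_norm_upper: "rep_seminorm G R p \<Longrightarrow> x \<in> free_alg G \<Longrightarrow> p x \<le> N x"
  unfolding univ_norm_alt
  by (rule cSUP_upper) (use rep_seminorms_bounded in \<open>auto intro: bdd_aboveI2 simp: bdd_above_def\<close>)

lemma univ_norm_least: "(\<And>p. rep_seminorm G R p \<Longrightarrow> p x \<le> C) \<Longrightarrow> N x \<le> C"
  unfolding univ_norm_alt by (rule cSUP_least) (use rep_seminorm_zero in auto)

lemma univ_norm_nonneg: "x \<in> free_alg G \<Longrightarrow> 0 \<le> N x"
  using univ_norm_upper[OF rep_seminorm_zero] .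

lemma univ_norm_vanishing: "x \<in> vanishing G R \<Longrightarrow> N x = 0"
  using univ_norm_nonneg[of x] univ_norm_least[of x 0] by (force simp: vanishing_def)

lemma univ_norm_add:
  assumes "x \<in> free_alg G" "y \<in> free_alg G" shows "N (x + y) \<le> N x + N y"
proof (rule univ_norm_least)
  fix p assume "rep_seminorm G R p"
  then show "p (x + y) \<le> N x + N y"
    using assms cstar_seminorm_add[of G p x y] univ_norm_upper[of p x] univ_norm_upper[of p y]
    by (simp add: rep_seminorm_def)
qed

lemma univ_norm_mult:
  assumes "x \<in> free_alg G" "y \<in> free_alg G" shows "N (x * y) \<le> N x * N y"
proof (rule univ_norm_least)
  fix p assume p: "rep_seminorm G R p"
  have "p x * p y \<le> N x * N y"
    using assms p univ_norm_nonneg[of x] cstar_seminorm_nonneg[of G p y]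
    by (intro mult_mono univ_norm_upper[of p]) (auto simp: rep_seminorm_def)
  then show "p (x * y) \<le> N x * N y"
    using assms p cstar_seminorm_mult[of G p x y] by (simp add: rep_seminorm_def)
qed

lemma univ_norm_fscale:
  assumes "x \<in> free_alg G" shows "N (fscale c x) \<le> cmod c * N x"
proof (rule univ_norm_least)
  fix p assume "rep_seminorm G R p"
  then show "p (fscale c x) \<le> cmod c * N x"
    using assms univ_norm_upper[of p x] cstar_seminorm_scale[of G p x c]
    by (simp add: rep_seminorm_def mult_left_mono)
qed

lemma univ_norm_fstar:
  assumes "x \<in> free_alg G" shows "N (fstar x) = N x"
  unfolding univ_norm_alt
  by (rule SUP_cong) (use assms in \<open>auto simp: rep_seminorm_def cstar_seminorm_fstar\<close>)

lemma univ_norm_minus: "x \<in> free_alg G \<Longrightarrow> N (- x) = N x"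
  unfolding univ_norm_alt
  by (rule SUP_cong) (auto simp: rep_seminorm_def cstar_seminorm_minus)

lemma univ_norm_zero [simp]: "N 0 = 0"
  by (simp add: univ_norm_vanishing)

end


section \<open>The separated completion\<close>

context bounded_presentation
begin

abbreviation "\<C> \<equiv> cauchy_ring G R"
abbreviation "\<N> \<equiv> null_ideal G R"

lemma cauchy_carrier_iff:
  "X \<in> carrier \<C> \<longleftrightarrow> (\<forall>n. X n \<in> free_alg G) \<and> (\<forall>e>0. \<exists>M. \<forall>m\<ge>M. \<forall>n\<ge>M. N (X m - X n) < e)"
  by (simp add: cauchy_ring_def)

lemma cauchy_free_alg [simp]: "X \<in> carrier \<C> \<Longrightarrow> X n \<in> free_alg G"
  by (simp add: cauchy_carrier_iff)

lemma cauchy_ring_ops [simp]: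
  "X \<otimes>\<^bsub>\<C>\<^esub> Y = (\<lambda>n. X n * Y n)" "X \<oplus>\<^bsub>\<C>\<^esub> Y = (\<lambda>n. X n + Y n)"
  "\<one>\<^bsub>\<C>\<^esub> = (\<lambda>_. 1)" "\<zero>\<^bsub>\<C>\<^esub> = (\<lambda>_. 0)"
  by (simp_all only: cauchy_ring_def monoid.simps ring.simps)

lemma null_ideal_iff: "X \<in> \<N> \<longleftrightarrow> (\<forall>n. X n \<in> free_alg G) \<and> (\<lambda>n. N (X n)) \<longlonglongrightarrow> 0"
  by (simp add: null_ideal_def)

lemma null_idealI:
  assumes "\<And>n. X n \<in> free_alg G" and "\<And>n. N (X n) \<le> b n" and "b \<longlonglongrightarrow> 0"
  shows "X \<in> \<N>"
proof -
  have "(\<lambda>n. N (X n)) \<longlonglongrightarrow> 0"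
    by (rule tendsto_sandwich[OF _ _ tendsto_const assms(3)])
      (use assms univ_norm_nonneg in auto)
  with assms(1) show ?thesis by (simp add: null_ideal_iff)
qed

lemma cauchy_const [simp]: "x \<in> free_alg G \<Longrightarrow> (\<lambda>_. x) \<in> carrier \<C>"
  by (simp add: cauchy_carrier_iff)

lemma null_imp_cauchy:
  assumes "X \<in> \<N>" shows "X \<in> carrier \<C>"
proof -
  have X: "X n \<in> free_alg G" for n using assms by (simp add: null_ideal_iff)
  have "\<exists>M. \<forall>m\<ge>M. \<forall>n\<ge>M. N (X m - X n) < e" if "e > 0" for e
  proof -
    have "(\<lambda>n. N (X n)) \<longlonglongrightarrow> 0" and "e / 2 > 0"
      using assms that by (auto simp: null_ideal_iff)
    then obtain M where M: "N (X n) < e / 2" if "n \<ge> M" for n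
      using order_tendstoD(2)[of "\<lambda>n. N (X n)" 0 sequentially "e / 2"]
      unfolding eventually_sequentially by blast
    have "N (X m - X n) < e" if "m \<ge> M" "n \<ge> M" for m n
      using univ_norm_add[of "X m" "- X n"] M[OF that(1)] M[OF that(2)] X univ_norm_minus[OF X]
      by simp
    then show ?thesis by blast
  qed
  with X show ?thesis by (simp add: cauchy_carrier_iff)
qed

lemma cauchy_bounded:
  assumes X: "X \<in> carrier \<C>"
  obtains K where "K > 0" "\<And>n. N (X n) \<le> K"
proof -
  obtain M where M: "\<And>n. n \<ge> M \<Longrightarrow> N (X n - X M) < 1"
    using X unfolding cauchy_carrier_iff by (metis order_refl zero_less_one)
  define K where "K = 1 + N (X M) + (\<Sum>i<M. N (X i))"
  have nonneg: "0 \<le> N (X i)" for i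
    using X by (simp add: univ_norm_nonneg)
  have sum_nonneg: "0 \<le> (\<Sum>i<M. N (X i))"
    by (simp add: sum_nonneg nonneg)
  have "N (X n) \<le> K" for n
  proof (cases "n < M")
    case True
    then have "N (X n) \<le> (\<Sum>i<M. N (X i))"
      by (intro member_le_sum) (auto simp: nonneg)
    then show ?thesis using nonneg[of M] by (simp add: K_def)
  next
    case False
    then have "N (X n) \<le> N (X n - X M) + N (X M)"
      using univ_norm_add[of "X n - X M" "X M"] X by simp
    then show ?thesis using M[of n] False sum_nonneg by (simp add: K_def)
  qed
  moreover have "K > 0"
    using nonneg[of M] sum_nonneg by (simp add: K_def)
  ultimately show ?thesis using that by blast
qed

lemma cauchy_add [simp]:
  assumes X: "X \<in> carrier \<C>" and Y: "Y \<in> carrier \<C>"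
  shows "(\<lambda>n. X n + Y n) \<in> carrier \<C>"
proof -
  have "\<exists>M. \<forall>m\<ge>M. \<forall>n\<ge>M. N (X m + Y m - (X n + Y n)) < e" if e: "e > 0" for e
  proof -
    from e have "e / 2 > 0" by simp
    then obtain M M' where M: "\<forall>m\<ge>M. \<forall>n\<ge>M. N (X m - X n) < e / 2"
      and M': "\<forall>m\<ge>M'. \<forall>n\<ge>M'. N (Y m - Y n) < e / 2"
      using X Y unfolding cauchy_carrier_iff by blast
    have "N (X m + Y m - (X n + Y n)) < e" if "m \<ge> max M M'" "n \<ge> max M M'" for m n
    proof -
      have "N ((X m - X n) + (Y m - Y n)) \<le> N (X m - X n) + N (Y m - Y n)"
        using X Y by (intro univ_norm_add) simp_all
      also have "\<dots> < e / 2 + e / 2"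
        using M M' that by (intro add_strict_mono) auto
      finally show ?thesis by (simp add: algebra_simps)
    qed
    then show ?thesis by blast
  qed
  with X Y show ?thesis by (simp add: cauchy_carrier_iff)
qed

lemma cauchy_mult [simp]:
  assumes X: "X \<in> carrier \<C>" and Y: "Y \<in> carrier \<C>"
  shows "(\<lambda>n. X n * Y n) \<in> carrier \<C>"
proof -
  obtain K L where K: "K > 0" "\<And>n. N (X n) \<le> K" and L: "L > 0" "\<And>n. N (Y n) \<le> L"
    using cauchy_bounded[OF X] cauchy_bounded[OF Y] by metis
  have "\<exists>M. \<forall>m\<ge>M. \<forall>n\<ge>M. N (X m * Y m - X n * Y n) < e" if e: "e > 0" for e
  proof -
    from e K L have "e / (2 * L) > 0" "e / (2 * K) > 0" by simp_all
    then obtain M M' where M: "\<forall>m\<ge>M. \<forall>n\<ge>M. N (X m - X n) < e / (2 * L)"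
      and M': "\<forall>m\<ge>M'. \<forall>n\<ge>M'. N (Y m - Y n) < e / (2 * K)"
      using X Y unfolding cauchy_carrier_iff by blast
    have "N (X m * Y m - X n * Y n) < e" if "m \<ge> max M M'" "n \<ge> max M M'" for m n
    proof -
      have "X m * Y m - X n * Y n = (X m - X n) * Y m + X n * (Y m - Y n)"
        by (simp add: algebra_simps)
      then have "N (X m * Y m - X n * Y n) \<le> N ((X m - X n) * Y m) + N (X n * (Y m - Y n))"
        using univ_norm_add[of "(X m - X n) * Y m" "X n * (Y m - Y n)"] X Y by simp
      also have "\<dots> \<le> N (X m - X n) * N (Y m) + N (X n) * N (Y m - Y n)"
        using X Y by (intro add_mono univ_norm_mult) simp_all
      also have "\<dots> \<le> N (X m - X n) * L + K * N (Y m - Y n)"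
        using X Y K L by (intro add_mono mult_mono) (auto simp: univ_norm_nonneg)
      also have "\<dots> < e / (2 * L) * L + K * (e / (2 * K))"
        using M M' that K L
        by (intro add_strict_mono mult_strict_right_mono mult_strict_left_mono) auto
      also have "\<dots> = e"
        using K L by simp
      finally show ?thesis .
    qed
    then show ?thesis by blast
  qed
  with X Y show ?thesis by (simp add: cauchy_carrier_iff)
qed

lemma cauchy_minus [simp]:
  assumes X: "X \<in> carrier \<C>" shows "(\<lambda>n. - X n) \<in> carrier \<C>"
  using cauchy_mult[OF cauchy_const[of "- 1"] X] by simp

lemma ring_cauchy_ring: "ring \<C>"
proof (rule ringI)
  show "abelian_group \<C>"
  proof (rule abelian_groupI)
    fix X assume X: "X \<in> carrier \<C>"
    show "\<exists>Y\<in>carrier \<C>. Y \<oplus>\<^bsub>\<C>\<^esub> X = \<zero>\<^bsub>\<C>\<^esub>"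
      by (rule bexI[where x = "\<lambda>n. - X n"]) (use X in simp_all)
  qed (simp_all add: add_ac)
  show "Group.monoid \<C>"
    by (rule monoidI) (simp_all add: mult.assoc)
qed (simp_all add: algebra_simps)

sublocale C: ring \<C>
  by (rule ring_cauchy_ring)

lemma cauchy_a_inv: "X \<in> carrier \<C> \<Longrightarrow> \<ominus>\<^bsub>\<C>\<^esub> X = (\<lambda>n. - X n)"
  by (rule C.minus_equality) simp_all

lemma null_add:
  assumes X: "X \<in> \<N>" and Y: "Y \<in> \<N>"
  shows "(\<lambda>n. X n + Y n) \<in> \<N>"
proof (rule null_idealI)
  show "(\<lambda>n. N (X n) + N (Y n)) \<longlonglongrightarrow> 0"
    using tendsto_add[of "\<lambda>n. N (X n)" 0 sequentially "\<lambda>n. N (Y n)" 0] X Y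
    by (simp add: null_ideal_iff)
qed (use X Y in \<open>auto simp: null_ideal_iff univ_norm_add\<close>)

lemma null_mult:
  assumes X: "X \<in> carrier \<C>" and Y: "Y \<in> \<N>"
  shows "(\<lambda>n. X n * Y n) \<in> \<N>" and "(\<lambda>n. Y n * X n) \<in> \<N>"
proof -
  obtain K where K: "K > 0" "\<And>n. N (X n) \<le> K"
    using cauchy_bounded[OF X] by blast
  have lim: "(\<lambda>n. K * N (Y n)) \<longlonglongrightarrow> 0"
    using tendsto_mult_left[of "\<lambda>n. N (Y n)" 0 sequentially K] Y by (simp add: null_ideal_iff)
  have Y': "Y n \<in> free_alg G" for n
    using Y by (simp add: null_ideal_iff)
  have "N (X n * Y n) \<le> K * N (Y n)" and "N (Y n * X n) \<le> K * N (Y n)" for n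
  proof -
    have "N (X n) * N (Y n) \<le> K * N (Y n)"
      using K Y' by (simp add: mult_right_mono univ_norm_nonneg)
    then show "N (X n * Y n) \<le> K * N (Y n)" and "N (Y n * X n) \<le> K * N (Y n)"
      using univ_norm_mult[of "X n" "Y n"] univ_norm_mult[of "Y n" "X n"] X Y'
      by (simp_all add: mult.commute)
  qed
  then show "(\<lambda>n. X n * Y n) \<in> \<N>" and "(\<lambda>n. Y n * X n) \<in> \<N>"
    using X Y' by (auto intro!: null_idealI[OF _ _ lim])
qed

lemma ideal_null_ideal: "ideal \<N> \<C>"
proof (rule idealI)
  show "subgroup \<N> (add_monoid \<C>)"
  proof (rule C.add.subgroupI)
    show "\<N> \<noteq> {}"
      using null_idealI[of "\<lambda>_. 0" "\<lambda>_. 0"] by auto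
    show "\<ominus>\<^bsub>\<C>\<^esub> X \<in> \<N>" if "X \<in> \<N>" for X
      using that null_mult(1)[of "\<lambda>_. - 1" X] by (simp add: cauchy_a_inv null_imp_cauchy)
  qed (auto simp: null_imp_cauchy null_add)
qed (simp_all add: ring_cauchy_ring null_mult)

sublocale I: ideal \<N> \<C>
  by (rule ideal_null_ideal)

abbreviation "cls \<equiv> cauchy_class G R"

lemma cauchy_class_eq_iff:
  assumes "X \<in> carrier \<C>" "Y \<in> carrier \<C>"
  shows "cls X = cls Y \<longleftrightarrow> (\<lambda>n. X n - Y n) \<in> \<N>"
  using C.quotient_eq_iff_same_a_r_cos[OF ideal_null_ideal assms] assms
  by (simp add: cauchy_class_def a_minus_def cauchy_a_inv)

lemma cauchy_class_self: "X \<in> carrier \<C> \<Longrightarrow> X \<in> cls X"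
  by (simp add: cauchy_class_def I.a_rcos_self)

lemma cauchy_class_memD:
  assumes "X \<in> carrier \<C>" "Y \<in> cls X"
  shows "Y \<in> carrier \<C>" and "cls Y = cls X"
proof -
  show "cls Y = cls X"
    using I.a_repr_independence'[of Y X] assms by (simp add: cauchy_class_def)
  show "Y \<in> carrier \<C>"
    using assms I.a_elemrcos_carrier by (simp add: cauchy_class_def)
qed

lemma univ_cstar_carrier: "carrier (univ_cstar G R) = cls ` carrier \<C>"
  by (auto simp: univ_cstar_def ring.defs star_algebra.defs FactRing_def A_RCOSETS_def'
      cauchy_class_def)

lemma univ_cstar_mult:
  "X \<in> carrier \<C> \<Longrightarrow> Y \<in> carrier \<C> \<Longrightarrow> cls X \<otimes>\<^bsub>univ_cstar G R\<^esub> cls Y = cls (\<lambda>n. X n * Y n)"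
  by (simp add: univ_cstar_def ring.defs star_algebra.defs FactRing_def cauchy_class_def
      I.rcoset_mult_add)

lemma univ_cstar_add:
  "X \<in> carrier \<C> \<Longrightarrow> Y \<in> carrier \<C> \<Longrightarrow> cls X \<oplus>\<^bsub>univ_cstar G R\<^esub> cls Y = cls (\<lambda>n. X n + Y n)"
  by (simp add: univ_cstar_def ring.defs star_algebra.defs FactRing_def cauchy_class_def
      I.a_rcos_sum)

lemma univ_cstar_one: "\<one>\<^bsub>univ_cstar G R\<^esub> = cls (\<lambda>_. 1)"
  by (simp add: univ_cstar_def ring.defs star_algebra.defs FactRing_def cauchy_class_def)

end

text \<open>The maps between free algebras that extend to the completions.  Scalar multiplication
  and the adjoint are of this kind, and so is \<^const>\<open>free_ext\<close> of a map that respects the relators.\<close>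

locale bounded_additive_map =
  A: bounded_presentation G R + B: bounded_presentation H S
  for G :: "'g set" and R and H :: "'h set" and S +
  fixes f :: "'g falg \<Rightarrow> 'h falg"
  assumes closed: "x \<in> free_alg G \<Longrightarrow> f x \<in> free_alg H"
    and diff: "f (x - y) = f x - f y"
    and bounded: "\<exists>K. \<forall>x\<in>free_alg G. univ_norm H S (f x) \<le> K * univ_norm G R x"
begin

lemma null:
  assumes X: "X \<in> null_ideal G R" shows "(\<lambda>n. f (X n)) \<in> null_ideal H S"
proof -
  obtain K where K: "\<forall>x\<in>free_alg G. univ_norm H S (f x) \<le> K * univ_norm G R x"
    using bounded by blast
  show ?thesis
  proof (rule B.null_idealI)
    show "(\<lambda>n. K * univ_norm G R (X n)) \<longlonglongrightarrow> 0"
      using tendsto_mult_left[of "\<lambda>n. univ_norm G R (X n)" 0 sequentially K] X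
      by (simp add: A.null_ideal_iff)
  qed (use X K in \<open>auto simp: A.null_ideal_iff closed\<close>)
qed

lemma cauchy:
  assumes X: "X \<in> carrier (cauchy_ring G R)"
  shows "(\<lambda>n. f (X n)) \<in> carrier (cauchy_ring H S)"
proof -
  obtain K where K: "\<forall>x\<in>free_alg G. univ_norm H S (f x) \<le> K * univ_norm G R x"
    using bounded by blast
  have "\<exists>M. \<forall>m\<ge>M. \<forall>n\<ge>M. univ_norm H S (f (X m) - f (X n)) < e" if e: "e > 0" for e
  proof -
    have "e / (\<bar>K\<bar> + 1) > 0" using e by simp
    then obtain M where M: "\<forall>m\<ge>M. \<forall>n\<ge>M. univ_norm G R (X m - X n) < e / (\<bar>K\<bar> + 1)"
      using X unfolding A.cauchy_carrier_iff by blast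
    have "univ_norm H S (f (X m) - f (X n)) < e" if "m \<ge> M" "n \<ge> M" for m n
    proof -
      have mem: "X m - X n \<in> free_alg G" using X by simp
      have "univ_norm H S (f (X m) - f (X n)) \<le> K * univ_norm G R (X m - X n)"
        using K mem by (simp flip: diff)
      also have "\<dots> \<le> (\<bar>K\<bar> + 1) * univ_norm G R (X m - X n)"
        using A.univ_norm_nonneg[OF mem] by (intro mult_right_mono) auto
      also have "\<dots> < e"
        using M that by (simp add: pos_less_divide_eq mult.commute)
      finally show ?thesis .
    qed
    then show ?thesis by blast
  qed
  then show ?thesis
    using X by (simp add: B.cauchy_carrier_iff closed)
qed

lemma cauchy_class:
  assumes X: "X \<in> carrier (cauchy_ring G R)"
  shows "(\<Union>Y\<in>cauchy_class G R X. cauchy_class H S (\<lambda>n. f (Y n))) = cauchy_class H S (\<lambda>n. f (X n))"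
proof -
  have "cauchy_class H S (\<lambda>n. f (Y n)) = cauchy_class H S (\<lambda>n. f (X n))"
    if "Y \<in> cauchy_class G R X" for Y
  proof -
    have "Y \<in> carrier (cauchy_ring G R)" and "(\<lambda>n. Y n - X n) \<in> null_ideal G R"
      using A.cauchy_class_memD[OF X that] A.cauchy_class_eq_iff X by auto
    then show ?thesis
      using X by (simp add: B.cauchy_class_eq_iff cauchy null flip: diff)
  qed
  moreover have "X \<in> cauchy_class G R X"
    using X by (rule A.cauchy_class_self)
  ultimately show ?thesis by blast
qed

end

context bounded_presentation
begin

lemma univ_cstar_scale:
  assumes "X \<in> carrier \<C>"
  shows "(\<lambda>n. fscale c (X n)) \<in> carrier \<C>"
    and "scale (univ_cstar G R) c (cls X) = cls (\<lambda>n. fscale c (X n))"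
proof -
  interpret bounded_additive_map G R G R "fscale c"
    by unfold_locales (auto simp: fscale_diff intro: univ_norm_fscale)
  show "(\<lambda>n. fscale c (X n)) \<in> carrier \<C>"
    using assms by (rule cauchy)
  show "scale (univ_cstar G R) c (cls X) = cls (\<lambda>n. fscale c (X n))"
    using cauchy_class[OF assms] by (simp add: univ_cstar_def ring.defs star_algebra.defs)
qed

lemma univ_cstar_star:
  assumes "X \<in> carrier \<C>"
  shows "(\<lambda>n. fstar (X n)) \<in> carrier \<C>"
    and "star (univ_cstar G R) (cls X) = cls (\<lambda>n. fstar (X n))"
proof -
  interpret bounded_additive_map G R G R fstar
    by unfold_locales (auto intro!: exI[of _ 1] simp: univ_norm_fstar)
  show "(\<lambda>n. fstar (X n)) \<in> carrier \<C>"
    using assms by (rule cauchy)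
  show "star (univ_cstar G R) (cls X) = cls (\<lambda>n. fstar (X n))"
    using cauchy_class[OF assms] by (simp add: univ_cstar_def ring.defs star_algebra.defs)
qed

end

section \<open>Homomorphisms between universal C*-algebras\<close>

definition univ_map ::
  "('g \<Rightarrow> 'h falg) \<Rightarrow> 'h set \<Rightarrow> 'h falg set \<Rightarrow> (nat \<Rightarrow> 'g falg) set \<Rightarrow> (nat \<Rightarrow> 'h falg) set"
  where "univ_map f H S A = (\<Union>X\<in>A. cauchy_class H S (\<lambda>n. free_ext f (X n)))"

locale presentation_map =
  A: bounded_presentation G R + B: bounded_presentation H S
  for G :: "'g set" and R and H :: "'h set" and S +
  fixes f :: "'g \<Rightarrow> 'h falg"
  assumes gens: "f ` G \<subseteq> free_alg H"
    and relators: "free_ext f ` R \<subseteq> vanishing H S"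
begin

lemma contractive:
  assumes "x \<in> free_alg G"
  shows "univ_norm H S (free_ext f x) \<le> univ_norm G R x"
  by (rule B.univ_norm_least)
    (rule A.univ_norm_upper[OF rep_seminorm_free_ext[OF gens relators] assms])

sublocale bounded_additive_map G R H S "free_ext f"
  by unfold_locales (use contractive in \<open>auto intro!: exI[of _ 1] free_ext_closed[OF gens]\<close>)

lemma univ_map_class:
  "X \<in> carrier (cauchy_ring G R) \<Longrightarrow>
    univ_map f H S (cauchy_class G R X) = cauchy_class H S (\<lambda>n. free_ext f (X n))"
  by (simp add: univ_map_def cauchy_class)

lemma univ_map_gen:
  "g \<in> G \<Longrightarrow> univ_map f H S (univ_gen G R g) = cauchy_class H S (\<lambda>_. f g)"
  by (simp add: univ_gen_def univ_map_class)

lemma star_hom_univ_map: "star_hom (univ_cstar G R) (univ_cstar H S) (univ_map f H S)"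
  unfolding star_hom_def ring_hom_def
  by (auto simp: A.univ_cstar_carrier B.univ_cstar_carrier univ_map_class cauchy
      A.univ_cstar_mult B.univ_cstar_mult A.univ_cstar_add B.univ_cstar_add
      A.univ_cstar_one B.univ_cstar_one A.univ_cstar_scale B.univ_cstar_scale
      A.univ_cstar_star B.univ_cstar_star)

end

text \<open>Both substitutions pass to the completions.  A composite of the two differs from the identity by
  vanishing elements on the generators; the vanishing elements form a *-ideal, so the same is true on
  the whole free algebra, and there the difference has norm \<open>0\<close>.\<close>

theorem univ_cstar_iso:
  assumes f: "presentation_map G R H S f" and g: "presentation_map H S G R g"
    and gf: "\<And>a. a \<in> G \<Longrightarrow> free_ext g (f a) - gen a \<in> vanishing G R"
    and fg: "\<And>b. b \<in> H \<Longrightarrow> free_ext f (g b) - gen b \<in> vanishing H S"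
  shows "star_iso (univ_cstar G R) (univ_cstar H S) (univ_map f H S)"
proof -
  interpret f: presentation_map G R H S f by fact
  interpret g: presentation_map H S G R g by fact
  have inverse: "univ_map k K T (univ_map h L U A) = A"
    if h: "presentation_map K T L U h" and k: "presentation_map L U K T k"
      and kh: "\<And>a. a \<in> K \<Longrightarrow> free_ext k (h a) - gen a \<in> vanishing K T"
      and A: "A \<in> carrier (univ_cstar K T)"
    for K :: "'x set" and T and L :: "'y set" and U h k A
  proof -
    interpret h: presentation_map K T L U h by fact
    interpret k: presentation_map L U K T k by fact
    have sub: "free_ext k (free_ext h x) - x \<in> vanishing K T" if "x \<in> free_alg K" for x
      using that
    proof (induction x rule: free_alg_induct)
      case (adj a)
      then show ?case using vanishing_fstar[OF kh[OF adj]] by simp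
    next
      case (mult x y)
      have "(free_ext k (free_ext h x) - x) * free_ext k (free_ext h y) \<in> vanishing K T"
        and "x * (free_ext k (free_ext h y) - y) \<in> vanishing K T"
        using mult by (auto intro!: vanishing_mult k.closed h.closed free_alg_diff)
      from vanishing_add[OF this] show ?case by (simp add: algebra_simps)
    next
      case (add x y)
      from vanishing_add[OF add.IH] show ?case by (simp add: algebra_simps)
    qed (simp_all add: free_ext_scalar kh)
    obtain X where X: "X \<in> carrier (cauchy_ring K T)" and A_eq: "A = cauchy_class K T X"
      using A by (auto simp: h.A.univ_cstar_carrier)
    have "(\<lambda>n. free_ext k (free_ext h (X n)) - X n) \<in> null_ideal K T"
      using X by (simp add: h.A.null_ideal_iff h.A.univ_norm_vanishing sub k.closed h.closed)
    then show ?thesis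
      using X by (simp add: A_eq h.univ_map_class k.univ_map_class h.cauchy k.cauchy
          h.A.cauchy_class_eq_iff)
  qed
  have maps: "univ_map f H S \<in> carrier (univ_cstar G R) \<rightarrow> carrier (univ_cstar H S)"
    and "univ_map g G R \<in> carrier (univ_cstar H S) \<rightarrow> carrier (univ_cstar G R)"
    using f.star_hom_univ_map g.star_hom_univ_map by (auto simp: star_hom_def ring_hom_def)
  then have "bij_betw (univ_map f H S) (carrier (univ_cstar G R)) (carrier (univ_cstar H S))"
    by (intro bij_betwI[where g = "univ_map g G R"]) (auto simp: inverse[OF f g gf] inverse[OF g f fg])
  with f.star_hom_univ_map show ?thesis by (simp add: star_iso_def)
qed


section \<open>Right ideals of the adding machine semigroup\<close>

abbreviation "\<P> \<equiv> adding_machine_zs"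

lemma carrier_zs [simp]: "carrier \<P> = UNIV"
  by (simp add: adding_machine_zs_def)

lemma mult_zs [simp]: "(v, g) \<otimes>\<^bsub>\<P>\<^esub> (z, h) = (v @ act g z, res g z + h)"
  by (simp add: adding_machine_zs_def)

lemma length_act [simp]: "length (act n v) = length v"
proof -
  have "length (gamma_act w) = length w" for w
    by (induction w rule: gamma_act.induct) auto
  then show ?thesis by (induction n) auto
qed

lemma inj_act: "act n v = act n w \<Longrightarrow> v = w"
proof -
  have "v = w" if "gamma_act v = gamma_act w" for v w
    using that
  proof (induction v arbitrary: w rule: gamma_act.induct)
    case (2 v)
    then show ?case by (cases w rule: gamma_act.cases) auto
  next
    case (3 v)
    then show ?case by (cases w rule: gamma_act.cases) auto
  qed (metis gamma_act.simps neq_Nil_conv digit.exhaust list.distinct(1))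
  then show "act n v = act n w \<Longrightarrow> v = w"
    by (induction n) auto
qed

lemma surj_act: "\<exists>v. act n v = w"
proof -
  have gamma: "\<exists>v. gamma_act v = w" for w
  proof (induction w)
    case Nil
    show ?case by (rule exI[of _ "[]"]) simp
  next
    case (Cons d w)
    then obtain v where "gamma_act v = w" by blast
    then have "gamma_act (case d of D0 \<Rightarrow> D1 # v | D1 \<Rightarrow> D0 # w) = d # w"
      by (cases d) auto
    then show ?case by blast
  qed
  show ?thesis
  proof (induction n arbitrary: w)
    case (Suc n)
    from gamma obtain v where "gamma_act v = w" by blast
    with Suc[of v] show ?case by auto
  qed simp
qed

lemma mem_principal:
  "(v, m) \<in> principal \<P> (x, g) \<longleftrightarrow> (\<exists>z. v = x @ act g z \<and> res g z \<le> m)"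
proof
  assume "\<exists>z. v = x @ act g z \<and> res g z \<le> m"
  then obtain z where "v = x @ act g z" "res g z \<le> m" by blast
  then have "(v, m) = (x, g) \<otimes>\<^bsub>\<P>\<^esub> (z, m - res g z)" by simp
  moreover have "p \<otimes>\<^bsub>\<P>\<^esub> q \<in> principal \<P> p" for p q
    unfolding principal_def l_coset_def carrier_zs by blast
  ultimately show "(v, m) \<in> principal \<P> (x, g)" by metis
qed (auto simp: principal_def l_coset_def)

lemma principal_one: "principal \<P> ([], 0) = UNIV"
proof -
  have "act 0 v = v" "res 0 v = 0" for v by simp_all
  then show ?thesis by (auto simp: mem_principal)
qed

lemma principal_mult: "p <#\<^bsub>\<P>\<^esub> principal \<P> q = principal \<P> (p \<otimes>\<^bsub>\<P>\<^esub> q)"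
  unfolding principal_def l_coset_def
  by (auto simp: monoid.m_assoc[OF monoid_adding_machine_zs])

lemma l_coset_empty: "p <#\<^bsub>\<P>\<^esub> {} = {}"
  by (simp add: l_coset_def)

text \<open>Passing from \<open>g\<close> to \<open>g + k\<close> can only increase the second coordinate required above a given
  word, because \<open>(\<gamma>\<^sup>g\<gamma>\<^sup>k)|\<^sub>z = \<gamma>\<^sup>g|\<^sub>y \<gamma>\<^sup>k|\<^sub>z\<close> for \<open>y = \<gamma>\<^sup>k \<cdot> z\<close>.  Hence the
  principal ideals with a fixed first coordinate form a chain.\<close>

lemma principal_antimono:
  assumes "g \<le> h" shows "principal \<P> (x, h) \<subseteq> principal \<P> (x, g)"
proof -
  obtain k where h: "h = g + k" using assms le_Suc_ex by blast
  have "(v, m) \<in> principal \<P> (x, g)" if "(v, m) \<in> principal \<P> (x, h)" for v m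
  proof -
    from that obtain z where "v = x @ act g (act k z)" "res g (act k z) \<le> m"
      by (auto simp: mem_principal h act_add res_add)
    then show ?thesis unfolding mem_principal by blast
  qed
  then show ?thesis by auto
qed

lemma principal_inter_same:
  "principal \<P> (x, g) \<inter> principal \<P> (x, h) = principal \<P> (x, max g h)"
  using principal_antimono[of g h x] principal_antimono[of h g x] by (cases "g \<le> h") (auto simp: max_def)

text \<open>Below a longer word \<open>x\<close>, the ideal of \<open>(y, h)\<close> looks like one with first coordinate \<open>x\<close>; so the
  intersection with such an ideal reduces to a chain.\<close>

lemma principal_inter_prefix:
  assumes "prefix y x"
  shows "\<exists>k. principal \<P> (x, g) \<inter> principal \<P> (y, h) = principal \<P> (x, k)"
proof -
  from assms obtain x' where x: "x = y @ x'" by (auto simp: prefix_def)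
  obtain z where z: "act h z = x'" using surj_act by blast
  have "(x @ v, m) \<in> principal \<P> (y, h) \<longleftrightarrow> (x @ v, m) \<in> principal \<P> (x, res h z)" for v m
  proof
    assume "(x @ v, m) \<in> principal \<P> (y, h)"
    then obtain z' where z': "x' @ v = act h z'" "res h z' \<le> m"
      by (auto simp: mem_principal x)
    \<comment> \<open>Split \<open>z'\<close> where \<open>x'\<close> ends; as \<open>\<gamma>\<^sup>h\<close> acts injectively, the first part is \<open>z\<close>.\<close>
    define a b where "a = take (length x') z'" and "b = drop (length x') z'"
    have ab: "z' = a @ b" by (simp add: a_def b_def)
    moreover have "length z' = length x' + length v"
      using arg_cong[OF z'(1), of length] by simp
    then have "length (act h a) = length x'" by (simp add: a_def)
    ultimately have "act h a = x'" and v: "v = act (res h a) b"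
      using z'(1) by (simp_all add: act_append)
    then have "a = z" using z inj_act by blast
    with v ab z'(2) show "(x @ v, m) \<in> principal \<P> (x, res h z)"
      by (auto simp: mem_principal res_append)
  next
    assume "(x @ v, m) \<in> principal \<P> (x, res h z)"
    then obtain b where "v = act (res h z) b" "res (res h z) b \<le> m"
      by (auto simp: mem_principal)
    then have "x @ v = y @ act h (z @ b)" "res h (z @ b) \<le> m"
      by (simp_all add: x z act_append res_append)
    then show "(x @ v, m) \<in> principal \<P> (y, h)"
      unfolding mem_principal by blast
  qed
  then have "q \<in> principal \<P> (y, h) \<longleftrightarrow> q \<in> principal \<P> (x, res h z)" if "q \<in> principal \<P> (x, g)" for q
    using that by (cases q) (auto simp: mem_principal)
  then have "principal \<P> (x, g) \<inter> principal \<P> (y, h) = principal \<P> (x, g) \<inter> principal \<P> (x, res h z)"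
    by blast
  then show ?thesis by (auto simp: principal_inter_same)
qed

lemma principal_nonempty: "principal \<P> p \<noteq> {}"
  by (simp add: principal_def l_coset_def)

lemma principal_inter_parallel:
  assumes "x \<parallel> y"
  shows "principal \<P> (x, g) \<inter> principal \<P> (y, h) = {}"
proof -
  have False if "x @ a = y @ b" for a b
    using that assms by (metis prefixI prefix_same_cases parallel_def)
  then show ?thesis by (fastforce simp: mem_principal)
qed

lemma principal_inter_nonempty_iff:
  "principal \<P> (x, g) \<inter> principal \<P> (y, h) \<noteq> {} \<longleftrightarrow> prefix x y \<or> prefix y x"
proof
  assume "principal \<P> (x, g) \<inter> principal \<P> (y, h) \<noteq> {}"
  then show "prefix x y \<or> prefix y x"
    using principal_inter_parallel by blast
next
  assume "prefix x y \<or> prefix y x"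
  then show "principal \<P> (x, g) \<inter> principal \<P> (y, h) \<noteq> {}"
    using principal_inter_prefix[of x y h g] principal_inter_prefix[of y x g h] principal_nonempty
    by (metis inf_commute)
qed

lemma principal_eq_imp_fst_eq:
  assumes "principal \<P> (x, g) = principal \<P> (y, h)" shows "x = y"
proof -
  have "prefix v w" if eq: "principal \<P> (v, k) = principal \<P> (w, l)" for v w k l
  proof -
    have "(w, l) \<in> principal \<P> (w, l)"
      by (auto simp: mem_principal intro!: exI[of _ "[]"])
    then show ?thesis
      by (auto simp: mem_principal simp flip: eq)
  qed
  from this[OF assms] this[OF assms[symmetric]] show ?thesis
    by (rule prefix_order.antisym)
qed

lemma ideals_J_cases:
  assumes "Y \<in> ideals_J \<P>"
  obtains "Y = {}" | x g where "Y = principal \<P> (x, g)"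
  using assms by (auto simp: ideals_J_def)

lemma principal_in_ideals_J: "principal \<P> p \<in> ideals_J \<P>"
  by (simp add: ideals_J_def)

lemma UNIV_in_ideals_J: "UNIV \<in> ideals_J \<P>"
  using principal_in_ideals_J[of "([], 0)"] by (simp add: principal_one)

lemma empty_in_ideals_J: "{} \<in> ideals_J \<P>"
  by (simp add: ideals_J_def)

lemma l_coset_in_ideals_J: "Y \<in> ideals_J \<P> \<Longrightarrow> p <#\<^bsub>\<P>\<^esub> Y \<in> ideals_J \<P>"
  by (erule ideals_J_cases)
    (simp_all add: l_coset_empty empty_in_ideals_J principal_mult principal_in_ideals_J)

lemma inter_in_ideals_J:
  assumes Y: "Y \<in> ideals_J \<P>" and Z: "Z \<in> ideals_J \<P>"
  shows "Y \<inter> Z \<in> ideals_J \<P>"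
proof (cases "Y \<inter> Z = {}")
  case False
  with Y Z obtain x g y h where YZ: "Y = principal \<P> (x, g)" "Z = principal \<P> (y, h)"
    by (auto elim!: ideals_J_cases)
  with False have "prefix x y \<or> prefix y x"
    by (simp add: principal_inter_nonempty_iff)
  then obtain p where "Y \<inter> Z = principal \<P> p"
    using principal_inter_prefix[of x y h g] principal_inter_prefix[of y x g h] YZ
    by (metis inf_commute)
  then show ?thesis by (simp add: principal_in_ideals_J)
qed (simp add: empty_in_ideals_J)


section \<open>Families satisfying the relations of the 2-adic ring algebra\<close>

text \<open>The zero ring is admitted: the rings to which this is applied are given by presentations, which by
  themselves do not exclude \<open>1 = 0\<close>.\<close>

class star_ring = ring + monoid_mult +
  fixes adj :: "'a \<Rightarrow> 'a"
  assumes adj_adj [simp]: "adj (adj x) = x"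
    and adj_add: "adj (x + y) = adj x + adj y"
    and adj_mult [simp]: "adj (x * y) = adj y * adj x"
begin

lemma adj_zero [simp]: "adj 0 = 0"
  using adj_add[of 0 0] by simp

lemma adj_one [simp]: "adj 1 = 1"
  using adj_mult[of 1 "adj 1"] by simp

end

lemma isometry_mult:
  fixes a b :: "'a::star_ring"
  assumes "adj a * a = 1" "adj b * b = 1"
  shows "adj (a * b) * (a * b) = 1"
proof -
  have "adj (a * b) * (a * b) = adj b * (adj a * a) * b"
    by (simp only: adj_mult mult.assoc)
  with assms show ?thesis by simp
qed

lemma isometry_power:
  fixes a :: "'a::star_ring"
  assumes "adj a * a = 1"
  shows "adj (a ^ n) * a ^ n = 1"
proof (induction n)
  case (Suc n)
  show ?case
    unfolding power_Suc by (rule isometry_mult[OF assms Suc])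
qed simp

definition digit_isometry :: "'a::monoid_mult \<Rightarrow> 'a \<Rightarrow> digit \<Rightarrow> 'a"
  where "digit_isometry u s d = (case d of D0 \<Rightarrow> s | D1 \<Rightarrow> u * s)"

definition word_isometry :: "'a::monoid_mult \<Rightarrow> 'a \<Rightarrow> digit list \<Rightarrow> 'a"
  where "word_isometry u s v = prod_list (map (digit_isometry u s) v)"

text \<open>The element that represents the pair of a word \<open>v\<close> and the power \<open>\<gamma>\<^sup>n\<close>, once \<open>u\<close> represents
  \<open>\<gamma>\<close> and \<open>s\<close> represents the digit \<open>0\<close>.  The digit \<open>1\<close> is \<open>\<gamma> \<cdot> 0\<close> with trivial restriction, hence
  the factor \<open>u * s\<close>.\<close>

definition zs_element :: "'a::monoid_mult \<Rightarrow> 'a \<Rightarrow> digit list \<times> nat \<Rightarrow> 'a"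
  where "zs_element u s p = word_isometry u s (fst p) * u ^ snd p"

lemma zs_element_hom:
  assumes "\<And>x y. h (x * y) = h x * h y" and "h 1 = 1"
  shows "h (zs_element u s p) = zs_element (h u) (h s) p"
proof -
  have "h (u ^ n) = h u ^ n" for n
    by (induction n) (simp_all add: assms)
  moreover have "h (word_isometry u s v) = word_isometry (h u) (h s) v" for v
    by (induction v)
      (simp_all add: word_isometry_def digit_isometry_def assms split: digit.split)
  ultimately show ?thesis by (simp add: zs_element_def assms)
qed

locale q2_family =
  fixes u s :: "'a::star_ring"
  assumes unitary: "adj u * u = 1" "u * adj u = 1"
    and isometry: "adj s * s = 1"
    and commutation: "s * u = u\<^sup>2 * s"
    and range_sum: "s * adj s + u * s * adj s * adj u = 1"
begin

abbreviation "dig \<equiv> digit_isometry u s"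
abbreviation "word \<equiv> word_isometry u s"
abbreviation "el \<equiv> zs_element u s"

definition proj :: "digit list \<Rightarrow> 'a"
  where "proj v = word v * adj (word v)"

lemma word_simps: "word [] = 1" "word (d # v) = dig d * word v" "word (v @ w) = word v * word w"
  by (simp_all add: word_isometry_def)

lemma ranges_orthogonal: "adj s * u * s = 0"
proof -
  have "adj s * u * s = adj s * (s * adj s + u * s * adj s * adj u) * (u * s)"
    unfolding range_sum by (simp add: mult.assoc)
  also have "\<dots> = (adj s * s) * (adj s * u * s) + (adj s * u * s) * (adj s * (adj u * u) * s)"
    by (simp only: distrib_left distrib_right mult.assoc)
  \<comment> \<open>Compressing the relation by \<open>s\<^sup>*\<close> and \<open>u s\<close> yields \<open>x = x + x\<close> for \<open>x = s\<^sup>* u s\<close>.\<close>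
  finally have "adj s * u * s = adj s * u * s + adj s * u * s"
    by (simp add: isometry unitary)
  then show ?thesis by simp
qed

lemma digit_orthogonal: "adj (dig c) * dig d = (if c = d then 1 else 0)"
proof -
  have "adj (u * s) * s = 0"
    using arg_cong[OF ranges_orthogonal, of adj] by (simp add: mult.assoc)
  then show ?thesis
    using ranges_orthogonal isometry isometry_mult[OF unitary(1) isometry]
    by (cases c; cases d) (simp_all add: digit_isometry_def mult.assoc)
qed

lemma digit_cancel: "adj (dig c) * (dig d * x) = (if c = d then x else 0)"
  by (simp add: digit_orthogonal flip: mult.assoc)

lemma word_isometric: "adj (word v) * word v = 1"
  by (induction v) (simp_all add: word_simps mult.assoc digit_cancel)

lemma word_cancel: "adj (word v) * (word v * x) = x"
  by (simp add: word_isometric flip: mult.assoc)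

lemma word_orthogonal:
  assumes "v \<parallel> w" shows "adj (word v) * (word w * x) = 0"
proof -
  obtain a b b' c c' where "b \<noteq> c" "v = a @ b # b'" "w = a @ c # c'"
    using parallel_decomp[OF assms] by blast
  then show ?thesis
    by (simp add: word_simps mult.assoc word_cancel digit_cancel)
qed

text \<open>The range projections of the word isometries multiply as the principal ideals intersect, up to the
  power of \<open>\<gamma>\<close>, which a range projection does not see.\<close>

lemma proj_mult_word:
  "prefix v w \<Longrightarrow> proj v * word w = word w"
  "v \<parallel> w \<Longrightarrow> proj v * word w = 0"
  using word_orthogonal[of v w 1]
  by (auto simp: prefix_def proj_def word_simps mult.assoc word_cancel)

lemma adj_proj: "adj (proj v) = proj v"
  by (simp add: proj_def)

lemma proj_mult_proj:
  "prefix v w \<Longrightarrow> proj v * proj w = proj w"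
  "prefix w v \<Longrightarrow> proj v * proj w = proj v"
  "v \<parallel> w \<Longrightarrow> proj v * proj w = 0"
proof -
  show le: "proj v * proj w = proj w" if "prefix v w" for v w
    using proj_mult_word(1)[OF that] by (simp add: proj_def[of w] flip: mult.assoc)
  show "proj v * proj w = proj v" if "prefix w v"
    using arg_cong[OF le[OF that], of adj] by (simp add: adj_proj)
  show "proj v * proj w = 0" if "v \<parallel> w"
    using proj_mult_word(2)[OF that] by (simp add: proj_def[of w] flip: mult.assoc)
qed

text \<open>The relation \<open>s u = u\<^sup>2 s\<close> is the carry rule: \<open>u (u s) = s u\<close> says that adding one to the digit
  \<open>1\<close> leaves the digit \<open>0\<close> and passes \<open>u\<close> on to the rest of the word.\<close>

lemma u_word: "u * word v = word (gamma_act v) * u ^ gamma_res v"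
proof (induction v rule: gamma_act.induct)
  case (3 v)
  have "u * word (D1 # v) = u\<^sup>2 * s * word v"
    by (simp add: word_simps digit_isometry_def power2_eq_square mult.assoc)
  also have "\<dots> = s * (u * word v)"
    by (simp add: mult.assoc flip: commutation)
  finally show ?case
    by (simp add: 3 word_simps digit_isometry_def mult.assoc)
qed (simp_all add: word_simps digit_isometry_def mult.assoc)

lemma u_power_word: "u ^ n * word v = word (act n v) * u ^ res n v"
proof (induction n)
  case (Suc n)
  have "u ^ Suc n * word v = u * word (act n v) * u ^ res n v"
    by (simp add: mult.assoc Suc)
  then show ?case
    by (simp add: u_word mult.assoc power_add)
qed simp

lemma el_mult: "el p * el q = el (p \<otimes>\<^bsub>\<P>\<^esub> q)"
proof (cases p, cases q)
  fix v g z h assume pq: "p = (v, g)" "q = (z, h)"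
  have "el p * el q = word v * (u ^ g * word z) * u ^ h"
    by (simp add: pq zs_element_def mult.assoc)
  then show ?thesis
    by (simp add: pq zs_element_def u_power_word word_simps power_add mult.assoc)
qed

lemma el_isometric: "adj (el p) * el p = 1"
  unfolding zs_element_def
  by (intro isometry_mult word_isometric isometry_power unitary)

lemma el_range: "el p * adj (el p) = proj (fst p)"
proof -
  have "adj (u ^ n) = adj u ^ n" for n
    by (induction n) (simp_all add: power_commutes)
  then have "u ^ n * adj (u ^ n) = 1" for n
    using left_right_inverse_power[OF unitary(2)] by simp
  then have "u ^ n * (adj (u ^ n) * x) = x" for n x
    by (simp flip: mult.assoc)
  then show ?thesis by (simp add: zs_element_def proj_def mult.assoc)
qed

text \<open>The words of any fixed length have ranges that add up to \<open>1\<close>.  This is the form in which that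
  fact is used; it avoids the sums, as \<open>range_sum\<close> is applied to the last digit of the words.\<close>

lemma zero_if_kills_words:
  assumes "\<And>v. length v = n \<Longrightarrow> y * word v = 0"
  shows "y = 0"
  using assms
proof (induction n)
  case 0
  from 0[of "[]"] show ?case by (simp add: word_simps)
next
  case (Suc n)
  have "y * word v = 0" if "length v = n" for v :: "digit list"
  proof -
    have kill: "y * word v * dig d = 0" for d
      using Suc.prems[of "v @ [d]"] that by (simp add: word_simps mult.assoc)
    have "y * word v = y * word v * (dig D0 * adj (dig D0) + dig D1 * adj (dig D1))"
      using range_sum by (simp add: digit_isometry_def mult.assoc)
    also have "\<dots> = y * word v * dig D0 * adj (dig D0) + y * word v * dig D1 * adj (dig D1)"
      by (simp only: distrib_left mult.assoc)
    also have "\<dots> = 0" by (simp only: kill mult_zero_left add_0)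
    finally show ?thesis .
  qed
  then show ?case by (rule Suc.IH)
qed

text \<open>A word \<open>v\<close> at least as long as all the first coordinates is comparable with one of them by the
  foundation property, hence has it as a prefix, and then the corresponding factor annihilates
  the isometry of \<open>v\<close>.\<close>

lemma foundation_product:
  assumes "foundation_set \<P> (set ps)"
  shows "prod_list (map (\<lambda>p. 1 - proj (fst p)) ps) = 0"
proof (rule zero_if_kills_words)
  \<comment> \<open>The sum of the lengths serves as an upper bound for each of them.\<close>
  fix v :: "digit list" assume v: "length v = sum_list (map (\<lambda>p. length (fst p)) ps)"
  have short: "length (fst p) \<le> length v" if "p \<in> set ps" for p
    using that by (simp add: v member_le_sum_list)
  have "prod_list (map (\<lambda>p. 1 - proj (fst p)) qs) * word v =
    (if \<exists>p\<in>set qs. prefix (fst p) v then 0 else word v)" if "set qs \<subseteq> set ps" for qs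
    using that
  proof (induction qs)
    case (Cons q qs)
    have "(1 - proj (fst q)) * word v = (if prefix (fst q) v then 0 else word v)"
    proof (cases "prefix (fst q) v")
      case False
      then have "fst q \<parallel> v"
        using short[of q] Cons.prems by (auto simp: parallel_def prefix_def)
      with False show ?thesis by (simp add: left_diff_distrib proj_mult_word)
    qed (simp add: left_diff_distrib proj_mult_word)
    with Cons show ?case by (auto simp: mult.assoc)
  qed simp
  moreover have "\<exists>p\<in>set ps. prefix (fst p) v"
  proof -
    obtain p where p: "p \<in> set ps" "principal \<P> (v, 0) \<inter> principal \<P> p \<noteq> {}"
      using assms unfolding foundation_set_def carrier_zs by blast
    then have "prefix v (fst p) \<or> prefix (fst p) v"
      using principal_inter_nonempty_iff[of v 0 "fst p" "snd p"] by simp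
    then have "prefix (fst p) v"
      using short[OF p(1)] prefix_length_le by (metis le_antisym not_equal_is_parallel parallelD1 prefix_order.refl)
    with p(1) show ?thesis by blast
  qed
  ultimately show "prod_list (map (\<lambda>p. 1 - proj (fst p)) ps) * word v = 0"
    by simp
qed

text \<open>The generator of the ideal is recovered by choice.  Only its word enters the range projection, by
  \<open>el_range\<close>, and the ideal determines that word.\<close>

definition ideal_proj :: "(digit list \<times> nat) set \<Rightarrow> 'a"
  where "ideal_proj Y =
    (if Y = {} then 0 else let p = SOME p. principal \<P> p = Y in el p * adj (el p))"

lemma ideal_proj_empty [simp]: "ideal_proj {} = 0"
  by (simp add: ideal_proj_def)

lemma ideal_proj_principal [simp]: "ideal_proj (principal \<P> (x, g)) = proj x"
proof -
  define q where "q = (SOME q. principal \<P> q = principal \<P> (x, g))"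
  have "principal \<P> q = principal \<P> (x, g)"
    unfolding q_def by (rule someI) (rule refl)
  then have "fst q = x"
    by (metis principal_eq_imp_fst_eq prod.collapse)
  then show ?thesis
    using principal_nonempty by (simp add: ideal_proj_def q_def[symmetric] el_range)
qed

lemma ideal_proj_UNIV: "ideal_proj UNIV = 1"
  using ideal_proj_principal[of "[]" 0] by (simp add: principal_one proj_def word_simps)

lemma adj_ideal_proj: "Y \<in> ideals_J \<P> \<Longrightarrow> adj (ideal_proj Y) = ideal_proj Y"
  by (erule ideals_J_cases) (simp_all add: adj_proj)

lemma ideal_proj_covariant:
  assumes "Y \<in> ideals_J \<P>"
  shows "el p * ideal_proj Y * adj (el p) = ideal_proj (p <#\<^bsub>\<P>\<^esub> Y)"
  using assms
proof (cases rule: ideals_J_cases)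
  case (2 x g)
  have "el p * ideal_proj Y * adj (el p) = (el p * el (x, g)) * adj (el p * el (x, g))"
    by (simp add: 2 el_range[of "(x, g)", simplified, symmetric] mult.assoc)
  also have "\<dots> = proj (fst (p \<otimes>\<^bsub>\<P>\<^esub> (x, g)))"
    by (simp only: el_mult el_range)
  finally show ?thesis
    using ideal_proj_principal[of "fst (p \<otimes>\<^bsub>\<P>\<^esub> (x, g))" "snd (p \<otimes>\<^bsub>\<P>\<^esub> (x, g))"]
    by (simp add: 2 principal_mult)
qed (simp add: l_coset_empty)

lemma ideal_proj_inter:
  assumes "Y \<in> ideals_J \<P>" "Z \<in> ideals_J \<P>"
  shows "ideal_proj Y * ideal_proj Z = ideal_proj (Y \<inter> Z)"
proof (cases "Y = {} \<or> Z = {}")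
  case False
  with assms obtain x g y h where YZ: "Y = principal \<P> (x, g)" "Z = principal \<P> (y, h)"
    by (auto elim!: ideals_J_cases)
  consider "prefix x y" | "prefix y x" | "x \<parallel> y" by blast
  then show ?thesis
  proof cases
    case 1
    then obtain k where "Y \<inter> Z = principal \<P> (y, k)"
      using principal_inter_prefix[of x y h g] YZ by (metis inf_commute)
    then show ?thesis using 1 by (simp add: YZ proj_mult_proj)
  next
    case 2
    then obtain k where "Y \<inter> Z = principal \<P> (x, k)"
      using principal_inter_prefix[of y x g h] YZ by metis
    then show ?thesis using 2 by (simp add: YZ proj_mult_proj)
  next
    case 3
    then show ?thesis
      by (simp add: YZ proj_mult_proj principal_inter_parallel)
  qed
qed auto

end


section \<open>Families satisfying the relations of the boundary quotient\<close>

locale bq_family =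
  fixes w :: "digit list \<times> nat \<Rightarrow> 'a::star_ring" and e :: "(digit list \<times> nat) set \<Rightarrow> 'a"
  assumes w_isometry: "adj (w p) * w p = 1"
    and w_mult: "w p * w q = w (p \<otimes>\<^bsub>\<P>\<^esub> q)"
    and covariant: "Y \<in> ideals_J \<P> \<Longrightarrow> w p * e Y * adj (w p) = e (p <#\<^bsub>\<P>\<^esub> Y)"
    and e_UNIV: "e UNIV = 1" and e_empty: "e {} = 0"
    and e_inter: "Y \<in> ideals_J \<P> \<Longrightarrow> Z \<in> ideals_J \<P> \<Longrightarrow> e Y * e Z = e (Y \<inter> Z)"
    and foundation: "distinct ps \<Longrightarrow> foundation_set \<P> (set ps) \<Longrightarrow>
      prod_list (map (\<lambda>p. 1 - e (principal \<P> p)) ps) = 0"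
begin

lemma range_proj: "w p * adj (w p) = e (principal \<P> p)"
  using covariant[OF UNIV_in_ideals_J, of p] by (simp add: e_UNIV principal_def)

lemma w_one: "w ([], 0) = 1"
proof -
  have "w ([], 0) * w ([], 0) = w ([], 0)" by (simp add: w_mult)
  then have "adj (w ([], 0)) * (w ([], 0) * w ([], 0)) = 1" by (simp add: w_isometry)
  then show ?thesis by (simp add: w_isometry flip: mult.assoc)
qed

text \<open>Two foundation sets are responsible for the relations that are not identities of the semigroup.
  Every principal ideal meets that of \<open>\<gamma>\<close>, because \<open>\<gamma>\<close> permutes the words of each length; so \<open>\<gamma>\<close> is represented
  by a unitary.  Every principal ideal meets that of the word \<open>0\<close> or that of the word \<open>1\<close>.\<close>

sublocale q2_family "w ([], 1)" "w ([D0], 0)"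
proof
  have one: "act 1 [D0] = [D1]" "res 1 [D0] = 0" and two: "act 2 [D0] = [D0]" "res 2 [D0] = 1"
    by (simp_all add: numeral_2_eq_2)
  have "foundation_set \<P> (set [([], 1)])"
    by (auto simp: foundation_set_def principal_inter_nonempty_iff)
  then show "w ([], 1) * adj (w ([], 1)) = 1"
    using foundation[of "[([], 1)]"] by (simp add: range_proj)
  have t1: "w ([], 1) * w ([D0], 0) = w ([D1], 0)"
    using one by (simp add: w_mult)
  have "(w ([], 1))\<^sup>2 = w ([], 2)"
    by (simp add: power2_eq_square w_mult numeral_2_eq_2)
  then show "w ([D0], 0) * w ([], 1) = (w ([], 1))\<^sup>2 * w ([D0], 0)"
    using two by (simp add: w_mult)
  let ?e0 = "e (principal \<P> ([D0], 0))" and ?e1 = "e (principal \<P> ([D1], 0))"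
  have "principal \<P> (v, m) \<inter> principal \<P> ([D0], 0) \<noteq> {} \<or>
    principal \<P> (v, m) \<inter> principal \<P> ([D1], 0) \<noteq> {}" for v m
  proof (cases v)
    case (Cons d v')
    then show ?thesis
      unfolding principal_inter_nonempty_iff by (cases d) simp_all
  qed (simp add: principal_inter_nonempty_iff)
  then have "foundation_set \<P> (set [([D0], 0), ([D1], 0)])"
    by (auto simp: foundation_set_def)
  then have "(1 - ?e0) * (1 - ?e1) = 0"
    using foundation[of "[([D0], 0), ([D1], 0)]"] by simp
  moreover have "[D0] \<parallel> [D1]"
    by (simp add: parallel_def)
  then have "?e0 * ?e1 = 0"
    by (simp add: e_inter principal_in_ideals_J principal_inter_parallel e_empty)
  ultimately have "?e0 + ?e1 = 1"
    by (simp add: algebra_simps)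
  then show "w ([D0], 0) * adj (w ([D0], 0)) +
    w ([], 1) * w ([D0], 0) * adj (w ([D0], 0)) * adj (w ([], 1)) = 1"
    by (simp add: mult.assoc del: One_nat_def flip: range_proj t1)
qed (rule w_isometry)+

lemma el_eq_w: "el p = w p"
proof -
  have u_power: "w ([], 1) ^ n = w ([], n)" for n
    by (induction n) (simp_all add: w_one w_mult)
  have dig_eq: "dig d = w ([d], 0)" for d
    by (cases d) (simp_all add: digit_isometry_def w_mult)
  have "word v = w (v, 0)" for v
    by (induction v) (simp_all add: word_simps w_one dig_eq w_mult del: One_nat_def)
  then show ?thesis
    by (cases p) (simp add: zs_element_def u_power w_mult del: One_nat_def)
qed

lemma ideal_proj_eq_e:
  assumes "Y \<in> ideals_J \<P>" shows "ideal_proj Y = e Y"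
  using assms
proof (cases rule: ideals_J_cases)
  case (2 x g)
  then show ?thesis
    using el_range[of "(x, g)"] by (simp add: el_eq_w range_proj del: One_nat_def)
qed (simp add: e_empty del: One_nat_def)

end


section \<open>The universal *-rings of the two presentations\<close>

text \<open>Modulo the vanishing elements both free algebras become *-rings, in which the algebra of the
  preceding sections applies to the classes of the generators.\<close>

definition congruent_mod :: "'g falg set \<Rightarrow> 'g falg \<Rightarrow> 'g falg \<Rightarrow> bool"
  where "congruent_mod R x y \<longleftrightarrow> x - y \<in> vanishing UNIV R"

lemma equivp_congruent_mod: "equivp (congruent_mod R)"
proof (rule equivpI)
  show "reflp (congruent_mod R)"
    by (simp add: reflp_def congruent_mod_def)
  show "symp (congruent_mod R)"
  proof (rule sympI)
    fix x y assume "congruent_mod R x y"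
    then show "congruent_mod R y x"
      using vanishing_minus[of "x - y" UNIV R] by (simp add: congruent_mod_def)
  qed
  show "transp (congruent_mod R)"
  proof (rule transpI)
    fix x y z assume "congruent_mod R x y" "congruent_mod R y z"
    then have "(x - y) + (y - z) \<in> vanishing UNIV R"
      unfolding congruent_mod_def by (rule vanishing_add)
    then show "congruent_mod R x z" by (simp add: congruent_mod_def)
  qed
qed

lemma congruent_mod_add:
  "congruent_mod R x x' \<Longrightarrow> congruent_mod R y y' \<Longrightarrow> congruent_mod R (x + y) (x' + y')"
  unfolding congruent_mod_def by (drule (1) vanishing_add) (simp add: algebra_simps)

lemma congruent_mod_minus: "congruent_mod R x x' \<Longrightarrow> congruent_mod R (- x) (- x')"
  unfolding congruent_mod_def by (drule vanishing_minus) simp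

lemma congruent_mod_diff:
  "congruent_mod R x x' \<Longrightarrow> congruent_mod R y y' \<Longrightarrow> congruent_mod R (x - y) (x' - y')"
  using congruent_mod_add[OF _ congruent_mod_minus, of R x x' y y'] by simp

lemma congruent_mod_mult:
  assumes "congruent_mod R x x'" "congruent_mod R y y'"
  shows "congruent_mod R (x * y) (x' * y')"
proof -
  have "(x - x') * y + x' * (y - y') \<in> vanishing UNIV R"
    using assms by (intro vanishing_add vanishing_mult) (simp_all add: congruent_mod_def)
  then show ?thesis by (simp add: congruent_mod_def algebra_simps)
qed

lemma congruent_mod_fstar: "congruent_mod R x x' \<Longrightarrow> congruent_mod R (fstar x) (fstar x')"
  unfolding congruent_mod_def by (drule vanishing_fstar) simp

lemmas congruent_mod_intros =
  congruent_mod_add congruent_mod_minus congruent_mod_diff congruent_mod_mult congruent_mod_fstar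

quotient_type q2_ring = "q2_name falg" / "congruent_mod q2_relators"
  by (rule equivp_congruent_mod)

instantiation q2_ring :: star_ring
begin

lift_definition zero_q2_ring :: q2_ring is 0 .
lift_definition one_q2_ring :: q2_ring is 1 .
lift_definition plus_q2_ring :: "q2_ring \<Rightarrow> q2_ring \<Rightarrow> q2_ring" is "(+)"
  by (rule congruent_mod_intros)
lift_definition minus_q2_ring :: "q2_ring \<Rightarrow> q2_ring \<Rightarrow> q2_ring" is "(-)"
  by (rule congruent_mod_intros)
lift_definition uminus_q2_ring :: "q2_ring \<Rightarrow> q2_ring" is uminus
  by (rule congruent_mod_intros)
lift_definition times_q2_ring :: "q2_ring \<Rightarrow> q2_ring \<Rightarrow> q2_ring" is "(*)"
  by (rule congruent_mod_intros)
lift_definition adj_q2_ring :: "q2_ring \<Rightarrow> q2_ring" is fstar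
  by (rule congruent_mod_intros)

instance
  by standard (transfer; simp add: equivp_reflp[OF equivp_congruent_mod] algebra_simps)+

end

type_synonym zs_name = "(digit list \<times> nat) bq_name"

quotient_type bq_ring = "zs_name falg" / "congruent_mod (bq_relators \<P>)"
  by (rule equivp_congruent_mod)

instantiation bq_ring :: star_ring
begin

lift_definition zero_bq_ring :: bq_ring is 0 .
lift_definition one_bq_ring :: bq_ring is 1 .
lift_definition plus_bq_ring :: "bq_ring \<Rightarrow> bq_ring \<Rightarrow> bq_ring" is "(+)"
  by (rule congruent_mod_intros)
lift_definition minus_bq_ring :: "bq_ring \<Rightarrow> bq_ring \<Rightarrow> bq_ring" is "(-)"
  by (rule congruent_mod_intros)
lift_definition uminus_bq_ring :: "bq_ring \<Rightarrow> bq_ring" is uminus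
  by (rule congruent_mod_intros)
lift_definition times_bq_ring :: "bq_ring \<Rightarrow> bq_ring \<Rightarrow> bq_ring" is "(*)"
  by (rule congruent_mod_intros)
lift_definition adj_bq_ring :: "bq_ring \<Rightarrow> bq_ring" is fstar
  by (rule congruent_mod_intros)

instance
  by standard (transfer; simp add: equivp_reflp[OF equivp_congruent_mod] algebra_simps)+

end

lemmas q2_class_hom =
  plus_q2_ring.abs_eq[symmetric] minus_q2_ring.abs_eq[symmetric] uminus_q2_ring.abs_eq[symmetric]
  times_q2_ring.abs_eq[symmetric] adj_q2_ring.abs_eq[symmetric]
  zero_q2_ring.abs_eq[symmetric] one_q2_ring.abs_eq[symmetric]

lemmas bq_class_hom =
  plus_bq_ring.abs_eq[symmetric] minus_bq_ring.abs_eq[symmetric] uminus_bq_ring.abs_eq[symmetric]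
  times_bq_ring.abs_eq[symmetric] adj_bq_ring.abs_eq[symmetric]
  zero_bq_ring.abs_eq[symmetric] one_bq_ring.abs_eq[symmetric]

lemma q2_class_eq_zero_iff: "abs_q2_ring x = 0 \<longleftrightarrow> x \<in> vanishing UNIV q2_relators"
  by (simp add: zero_q2_ring.abs_eq q2_ring.abs_eq_iff congruent_mod_def)

lemma bq_class_eq_zero_iff: "abs_bq_ring x = 0 \<longleftrightarrow> x \<in> vanishing UNIV (bq_relators \<P>)"
  by (simp add: zero_bq_ring.abs_eq bq_ring.abs_eq_iff congruent_mod_def)

lemma q2_class_power: "abs_q2_ring (x ^ n) = abs_q2_ring x ^ n"
  by (induction n) (simp_all add: q2_class_hom)

lemma q2_class_prod_list: "abs_q2_ring (prod_list xs) = prod_list (map abs_q2_ring xs)"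
  by (induction xs) (simp_all add: q2_class_hom)

lemma bq_class_power: "abs_bq_ring (x ^ n) = abs_bq_ring x ^ n"
  by (induction n) (simp_all add: bq_class_hom)

lemma bq_class_prod_list: "abs_bq_ring (prod_list xs) = prod_list (map abs_bq_ring xs)"
  by (induction xs) (simp_all add: bq_class_hom)

interpretation q2: q2_family "abs_q2_ring (gen U)" "abs_q2_ring (gen S2)"
proof -
  let ?u = "gen U" and ?s = "gen S2"
  have eq: "abs_q2_ring x = abs_q2_ring y" if "x - y \<in> q2_relators" for x y
    using that by (simp add: q2_ring.abs_eq_iff congruent_mod_def vanishing_relator)
  have "abs_q2_ring (fstar ?u * ?u) = abs_q2_ring 1"
    and "abs_q2_ring (?u * fstar ?u) = abs_q2_ring 1"
    and "abs_q2_ring (fstar ?s * ?s) = abs_q2_ring 1"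
    and "abs_q2_ring (?s * ?u) = abs_q2_ring (?u ^ 2 * ?s)"
    and "abs_q2_ring (?s * fstar ?s + ?u * ?s * fstar ?s * fstar ?u) = abs_q2_ring 1"
    by (rule eq; simp add: q2_relators_def Let_def)+
  then show "q2_family (abs_q2_ring ?u) (abs_q2_ring ?s)"
    by unfold_locales (simp_all add: q2_class_hom q2_class_power)
qed

lemma bq_relator_intros:
  "p \<in> carrier P \<Longrightarrow> fstar (gen (W p)) * gen (W p) - 1 \<in> bq_relators P"
  "Y \<in> ideals_J P \<Longrightarrow> gen (E Y) * gen (E Y) - gen (E Y) \<in> bq_relators P"
  "Y \<in> ideals_J P \<Longrightarrow> fstar (gen (E Y)) - gen (E Y) \<in> bq_relators P"
  "p \<in> carrier P \<Longrightarrow> q \<in> carrier P \<Longrightarrow>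
    gen (W p) * gen (W q) - gen (W (p \<otimes>\<^bsub>P\<^esub> q)) \<in> bq_relators P"
  "p \<in> carrier P \<Longrightarrow> Y \<in> ideals_J P \<Longrightarrow>
    gen (W p) * gen (E Y) * fstar (gen (W p)) - gen (E (p <#\<^bsub>P\<^esub> Y)) \<in> bq_relators P"
  "gen (E (carrier P)) - 1 \<in> bq_relators P"
  "gen (E {}) \<in> bq_relators P"
  "Y \<in> ideals_J P \<Longrightarrow> Z \<in> ideals_J P \<Longrightarrow>
    gen (E Y) * gen (E Z) - gen (E (Y \<inter> Z)) \<in> bq_relators P"
  "distinct ps \<Longrightarrow> foundation_set P (set ps) \<Longrightarrow>
    prod_list (map (\<lambda>p. 1 - gen (E (principal P p))) ps) \<in> bq_relators P"
  unfolding bq_relators_def Let_def by blast+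

interpretation bq: bq_family "\<lambda>p. abs_bq_ring (gen (W p))" "\<lambda>Y. abs_bq_ring (gen (E Y))"
proof -
  have eq: "abs_bq_ring x = abs_bq_ring y" if "x - y \<in> bq_relators \<P>" for x y
    using that by (simp add: bq_ring.abs_eq_iff congruent_mod_def vanishing_relator)
  note relations = bq_relator_intros[where P = \<P>, simplified carrier_zs]
  show "bq_family (\<lambda>p. abs_bq_ring (gen (W p))) (\<lambda>Y. abs_bq_ring (gen (E Y)))"
  proof
    show "adj (abs_bq_ring (gen (W p))) * abs_bq_ring (gen (W p)) = 1" for p
      using eq[OF relations(1)] by (simp add: bq_class_hom)
    show "abs_bq_ring (gen (W p)) * abs_bq_ring (gen (W q)) = abs_bq_ring (gen (W (p \<otimes>\<^bsub>\<P>\<^esub> q)))" for p q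
      using eq[OF relations(4)] by (simp add: bq_class_hom)
    show "abs_bq_ring (gen (W p)) * abs_bq_ring (gen (E Y)) * adj (abs_bq_ring (gen (W p)))
        = abs_bq_ring (gen (E (p <#\<^bsub>\<P>\<^esub> Y)))" if "Y \<in> ideals_J \<P>" for p Y
      using eq[OF relations(5)] that by (simp add: bq_class_hom)
    show "abs_bq_ring (gen (E UNIV)) = 1"
      using eq[OF relations(6)] by (simp add: bq_class_hom)
    show "abs_bq_ring (gen (E {})) = 0"
      using eq[of _ 0] relations(7) by (simp add: bq_class_hom)
    show "abs_bq_ring (gen (E Y)) * abs_bq_ring (gen (E Z)) = abs_bq_ring (gen (E (Y \<inter> Z)))"
      if "Y \<in> ideals_J \<P>" "Z \<in> ideals_J \<P>" for Y Z
      using eq[OF relations(8)] that by (simp add: bq_class_hom)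
    show "prod_list (map (\<lambda>p. 1 - abs_bq_ring (gen (E (principal \<P> p)))) ps) = 0"
      if "distinct ps" "foundation_set \<P> (set ps)" for ps
      using eq[of "prod_list (map (\<lambda>p. 1 - gen (E (principal \<P> p))) ps)" 0] relations(9)[OF that]
      by (simp add: bq_class_prod_list bq_class_hom o_def)
  qed
qed


section \<open>The isomorphism\<close>

lemma bounded_presentation_q2: "bounded_presentation UNIV q2_relators"
proof
  fix p and g :: q2_name assume p: "rep_seminorm UNIV q2_relators p"
  have "fstar (gen g) * gen g - 1 \<in> q2_relators"
    by (cases g) (auto simp: q2_relators_def Let_def)
  then show "p (gen g) \<le> 1"
    using p by (intro cstar_seminorm_gen_le_one[of UNIV]) (auto simp: rep_seminorm_def)
qed

lemma bounded_presentation_bq: "bounded_presentation (bq_names \<P>) (bq_relators \<P>)"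
proof
  fix p g assume p: "rep_seminorm (bq_names \<P>) (bq_relators \<P>) p" and g: "g \<in> bq_names \<P>"
  show "p (gen g) \<le> 1"
  proof (cases g)
    case (W q)
    then have "fstar (gen g) * gen g - 1 \<in> bq_relators \<P>"
      by (simp add: bq_relator_intros)
    then show ?thesis
      using p g by (intro cstar_seminorm_gen_le_one[of "bq_names \<P>"]) (auto simp: rep_seminorm_def)
  next
    case (E Y)
    with g have "Y \<in> ideals_J \<P>" by (auto simp: bq_names_def)
    with E have "gen g * gen g - gen g \<in> bq_relators \<P>" "fstar (gen g) - gen g \<in> bq_relators \<P>"
      by (simp_all add: bq_relator_intros)
    then show ?thesis
      using p g by (intro cstar_seminorm_projection_le_one[of "bq_names \<P>"]) (auto simp: rep_seminorm_def)
  qed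
qed

lemma gen_W [simp]: "gen (W p) \<in> free_alg (bq_names \<P>)"
  by (simp add: bq_names_def)

lemma gen_E [simp]: "Y \<in> ideals_J \<P> \<Longrightarrow> gen (E Y) \<in> free_alg (bq_names \<P>)"
  by (simp add: bq_names_def)

text \<open>That the relators for products of projections involve only names of the presentation is the right
  LCM property of the semigroup.\<close>

lemma bq_relators_in_free_alg: "bq_relators \<P> \<subseteq> free_alg (bq_names \<P>)"
proof -
  have "prod_list (map (\<lambda>p. 1 - gen (E (principal \<P> p))) ps) \<in> free_alg (bq_names \<P>)" for ps
    by (induction ps) (simp_all add: principal_in_ideals_J)
  then show ?thesis
    by (auto simp: bq_relators_def Let_def l_coset_in_ideals_J inter_in_ideals_J
        UNIV_in_ideals_J empty_in_ideals_J)
qed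

lemma bq_vanishingI:
  "x \<in> free_alg (bq_names \<P>) \<Longrightarrow> abs_bq_ring x = 0 \<Longrightarrow> x \<in> vanishing (bq_names \<P>) (bq_relators \<P>)"
  by (rule vanishing_UNIV_imp[OF bq_relators_in_free_alg]) (simp_all add: bq_class_eq_zero_iff)

primrec q2_to_bq :: "q2_name \<Rightarrow> zs_name falg" where
  "q2_to_bq U = gen (W ([], 1))"
| "q2_to_bq S2 = gen (W ([D0], 0))"

text \<open>The value at an ideal is the term that represents \<open>q2_family.ideal_proj\<close>, with the same choice of a
  generator of the ideal.\<close>

primrec bq_to_q2 :: "zs_name \<Rightarrow> q2_name falg" where
  "bq_to_q2 (W p) = zs_element (gen U) (gen S2) p"
| "bq_to_q2 (E Y) = (if Y = {} then 0 else let p = SOME p. principal \<P> p = Y in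
    zs_element (gen U) (gen S2) p * fstar (zs_element (gen U) (gen S2) p))"

lemma q2_class_zs_element: "abs_q2_ring (zs_element (gen U) (gen S2) p) = q2.el p"
  by (rule zs_element_hom) (simp_all add: q2_class_hom)

lemma q2_class_bq_to_q2:
  "abs_q2_ring (bq_to_q2 (W p)) = q2.el p"
  "abs_q2_ring (bq_to_q2 (E Y)) = q2.ideal_proj Y"
  by (simp_all add: q2_class_zs_element q2.ideal_proj_def q2_class_hom Let_def)

lemma bq_class_zs_element:
  "abs_bq_ring (free_ext q2_to_bq (zs_element (gen U) (gen S2) p)) = abs_bq_ring (gen (W p))"
proof -
  have "abs_bq_ring (free_ext q2_to_bq (zs_element (gen U) (gen S2) p)) = bq.el p"
    using zs_element_hom[of "\<lambda>x. abs_bq_ring (free_ext q2_to_bq x)" "gen U" "gen S2" p]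
    by (simp add: bq_class_hom)
  then show ?thesis by (simp only: bq.el_eq_w)
qed

lemma bq_class_bq_to_q2:
  assumes "b \<in> bq_names \<P>"
  shows "abs_bq_ring (free_ext q2_to_bq (bq_to_q2 b)) = abs_bq_ring (gen b)"
proof (cases b)
  case (W p)
  then show ?thesis by (simp only: bq_to_q2.simps bq_class_zs_element)
next
  case (E Y)
  have "abs_bq_ring (free_ext q2_to_bq (bq_to_q2 (E Y))) = bq.ideal_proj Y"
    by (simp add: bq.ideal_proj_def Let_def bq_class_hom bq_class_zs_element bq.el_eq_w del: One_nat_def)
  moreover have "Y \<in> ideals_J \<P>"
    using assms E by (auto simp: bq_names_def)
  ultimately show ?thesis
    by (simp only: E bq.ideal_proj_eq_e)
qed

lemma presentation_map_q2_to_bq: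
  "presentation_map UNIV q2_relators (bq_names \<P>) (bq_relators \<P>) q2_to_bq"
proof (intro presentation_map.intro presentation_map_axioms.intro
    bounded_presentation_q2 bounded_presentation_bq)
  have "q2_to_bq a \<in> free_alg (bq_names \<P>)" for a
    by (cases a) simp_all
  then show gens: "range q2_to_bq \<subseteq> free_alg (bq_names \<P>)" by blast
  have "free_ext q2_to_bq r \<in> vanishing (bq_names \<P>) (bq_relators \<P>)" if r: "r \<in> q2_relators" for r
  proof (rule bq_vanishingI)
    show "free_ext q2_to_bq r \<in> free_alg (bq_names \<P>)"
      by (rule free_ext_closed[OF gens]) simp
    show "abs_bq_ring (free_ext q2_to_bq r) = 0"
      using r bq.unitary bq.isometry bq.commutation bq.range_sum
      by (auto simp: q2_relators_def Let_def bq_class_hom bq_class_power)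
  qed
  then show "free_ext q2_to_bq ` q2_relators \<subseteq> vanishing (bq_names \<P>) (bq_relators \<P>)" by blast
qed

lemma presentation_map_bq_to_q2:
  "presentation_map (bq_names \<P>) (bq_relators \<P>) UNIV q2_relators bq_to_q2"
proof (intro presentation_map.intro presentation_map_axioms.intro
    bounded_presentation_q2 bounded_presentation_bq)
  have "abs_q2_ring (free_ext bq_to_q2 r) = 0" if "r \<in> bq_relators \<P>" for r
  proof -
    have idem: "q2.ideal_proj Y * q2.ideal_proj Y = q2.ideal_proj Y" if "Y \<in> ideals_J \<P>" for Y
      using q2.ideal_proj_inter[OF that that] by simp
    have prod: "prod_list (map (\<lambda>p. 1 - q2.ideal_proj (principal \<P> p)) ps) = 0"
      if "foundation_set \<P> (set ps)" for ps
    proof -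
      have "q2.ideal_proj (principal \<P> p) = q2.proj (fst p)" for p
        by (cases p) simp
      then show ?thesis using q2.foundation_product[OF that] by simp
    qed
    from \<open>r \<in> bq_relators \<P>\<close> show ?thesis
      unfolding bq_relators_def Let_def
      by (auto simp: q2_class_hom q2_class_prod_list q2_class_bq_to_q2 o_def q2.el_isometric idem prod
          q2.adj_ideal_proj q2.el_mult q2.ideal_proj_covariant q2.ideal_proj_UNIV q2.ideal_proj_inter
          simp del: bq_to_q2.simps mult_zs)
  qed
  then show "free_ext bq_to_q2 ` bq_relators \<P> \<subseteq> vanishing UNIV q2_relators"
    by (auto simp: q2_class_eq_zero_iff)
qed simp

theorem proposition6p8:
  shows "\<exists>\<phi>. star_iso Q2 (boundary_quotient adding_machine_zs) \<phi>
    \<and> \<phi> q2_u = zs_s 1 \<and> \<phi> q2_s2 = zs_t [D0]"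
proof -
  interpret presentation_map UNIV q2_relators "bq_names \<P>" "bq_relators \<P>" q2_to_bq
    by (rule presentation_map_q2_to_bq)
  let ?\<phi> = "univ_map q2_to_bq (bq_names \<P>) (bq_relators \<P>)"
  have "star_iso Q2 (boundary_quotient \<P>) ?\<phi>"
    unfolding Q2_def boundary_quotient_def
  proof (rule univ_cstar_iso[OF presentation_map_q2_to_bq presentation_map_bq_to_q2])
    fix a :: q2_name
    have "abs_q2_ring (free_ext bq_to_q2 (q2_to_bq a)) = abs_q2_ring (gen a)"
      by (cases a) (simp_all add: q2_class_zs_element zs_element_def word_isometry_def digit_isometry_def)
    then show "free_ext bq_to_q2 (q2_to_bq a) - gen a \<in> vanishing UNIV q2_relators"
      by (simp add: q2_class_hom flip: q2_class_eq_zero_iff)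
  next
    fix b assume b: "b \<in> bq_names \<P>"
    show "free_ext q2_to_bq (bq_to_q2 b) - gen b \<in> vanishing (bq_names \<P>) (bq_relators \<P>)"
      by (rule bq_vanishingI)
        (use b in \<open>simp_all add: closed bq_class_hom bq_class_bq_to_q2 del: bq_to_q2.simps\<close>)
  qed
  moreover have "?\<phi> q2_u = zs_s 1" "?\<phi> q2_s2 = zs_t [D0]"
    by (simp_all add: q2_u_def q2_s2_def zs_s_def zs_t_def bq_w_def univ_map_gen univ_gen_def[of "bq_names \<P>"])
  ultimately show ?thesis by blast
qed

end
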